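(* An arrangement consisting of the Komiya--Kuribayashi quartic, two of its bitangent lines and two of its hyperosculating lines, with the property that these $4$ lines intersect at one quadruple point, is plus-one generated.
   Context: Work over $\mathbb{C}$. The Komiya--Kuribayashi quartic is the smooth plane curve $x^4 + y^4 + z^4 + 3(x^2y^2 + x^2z^2 + y^2z^2)=0$ in $\mathbb{P}^2_{\mathbb{C}}$. A bitangent line of a smooth plane quartic is a line tangent to it at two points (the line cuts out a divisor $2P+2P'$ on the curve); when the two points coincide (the line cuts out $4P$) the line is called hyperosculating. The four lines in the arrangement are pairwise distinct. Let $S=\mathbb{C}[x,y,z]$. For a reduced curve $C: f=0$ of degree $d$ in $\mathbb{P}^2_{\mathbb{C}}$, let $J_f$ be the ideal generated by the partial derivatives of $f$ and $M(f)=S/J_f$ the Milnor algebra. $C$ is an $m$-syzygy curve if $M(f)$ has minimal graded free resolution $$0 \rightarrow \bigoplus_{i=1}^{m-2}S(-e_{i}) \rightarrow \bigoplus_{i=1}^{m}S(1-d - d_{i}) \rightarrow S^{3}(1-d)\rightarrow S \rightarrow M(f) \rightarrow 0$$ with $e_{1} \leq \dots \leq e_{m-2}$ and $1\leq d_{1} \leq \dots \leq d_{m}$. $C$ is plus-one generated (of level $d_3$) if it is a $3$-syzygy curve such that $d_1+d_2=d$ and $d_3>d_2$. An arrangement is called plus-one generated if the reduced curve that is the union of its members is. *)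

theory Defs
  imports
    "HOL-Analysis.Analysis"
    "HOL-Library.Poly_Mapping"
    "HOL-Computational_Algebra.Squarefree"
    "Jordan_Normal_Form.Matrix_Kernel"
begin

(* The symbol $ is also used by Jordan_Normal_Form for the entries of a vector. *)
unbundle no vec_syntax
notation vec_nth (infixl \<open>$h\<close> 90)

section \<open>The polynomial ring in three variables\<close>

text \<open>Monomials are exponent vectors indexed by the three-element type 3, whose elements
  are 1, 2 and 3 (where 3 = 0). Multiplication of poly-mappings is convolution, so this type
  is the polynomial ring S over the complex numbers.\<close>

type_synonym poly3 = "(3 \<Rightarrow>\<^sub>0 nat) \<Rightarrow>\<^sub>0 complex"

definition var :: "3 \<Rightarrow> poly3" where
  "var i = Poly_Mapping.single (Poly_Mapping.single i 1) 1"

definition const :: "complex \<Rightarrow> poly3" where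
  "const c = Poly_Mapping.single 0 c"

definition mdeg :: "(3 \<Rightarrow>\<^sub>0 nat) \<Rightarrow> nat" where
  "mdeg m = (\<Sum>i\<in>UNIV. Poly_Mapping.lookup m i)"

text \<open>The zero polynomial is homogeneous of every degree and is the only polynomial that is
  homogeneous of a negative degree.\<close>

definition homogeneous :: "int \<Rightarrow> poly3 \<Rightarrow> bool" where
  "homogeneous k p \<longleftrightarrow> (\<forall>m\<in>Poly_Mapping.keys p. int (mdeg m) = k)"

text \<open>The subtraction of exponents truncates only where the coefficient vanishes.\<close>

definition partial_deriv :: "3 \<Rightarrow> poly3 \<Rightarrow> poly3" where
  "partial_deriv i p = (\<Sum>m\<in>Poly_Mapping.keys p.
     Poly_Mapping.single (m - Poly_Mapping.single i 1)
       (of_nat (Poly_Mapping.lookup m i) * Poly_Mapping.lookup p m))"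

definition jacobian_ideal :: "poly3 \<Rightarrow> poly3 set" where
  "jacobian_ideal f = {(\<Sum>i\<in>UNIV. g i * partial_deriv i f) | g. True}"

section \<open>Minimal graded free resolutions\<close>

text \<open>A list of integers [a1, ..., an] stands for the graded free module
  S(-a1) + ... + S(-an), and a matrix over S acts on column vectors. The matrix A is a
  homomorphism of degree 0 from the module of b to the module of a.\<close>

definition graded_map :: "int list \<Rightarrow> int list \<Rightarrow> poly3 mat \<Rightarrow> bool" where
  "graded_map a b A \<longleftrightarrow> A \<in> carrier_mat (length a) (length b) \<and>
     (\<forall>i<length a. \<forall>j<length b. homogeneous (b ! j - a ! i) (A $$ (i, j)))"

definition mat_image :: "'a :: comm_ring_1 mat \<Rightarrow> 'a Matrix.vec set" where
  "mat_image A = (\<lambda>v. A *\<^sub>v v) ` carrier_vec (dim_col A)"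

text \<open>All entries lie in the ideal (x,y,z), i.e. the image of A is contained in (x,y,z)
  times the target module.\<close>

definition minimal_map :: "poly3 mat \<Rightarrow> bool" where
  "minimal_map A \<longleftrightarrow>
     (\<forall>i<dim_row A. \<forall>j<dim_col A. Poly_Mapping.lookup (A $$ (i, j)) 0 = 0)"

text \<open>There is a minimal graded free resolution
  0 -> F(b3) -> F(b2) -> F(b1) -> S -> S/I -> 0
  in which F(b) is the graded free module of the list b and S -> S/I is the projection.\<close>

definition has_minimal_graded_free_resolution ::
    "poly3 set \<Rightarrow> int list \<Rightarrow> int list \<Rightarrow> int list \<Rightarrow> bool" where
  "has_minimal_graded_free_resolution I b1 b2 b3 \<longleftrightarrow>
     (\<exists>A1 A2 A3. graded_map [0] b1 A1 \<and> graded_map b1 b2 A2 \<and> graded_map b2 b3 A3 \<and>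
        mat_image A1 = (\<lambda>p. Matrix.vec 1 (\<lambda>_. p)) ` I \<and>
        mat_kernel A1 = mat_image A2 \<and>
        mat_kernel A2 = mat_image A3 \<and>
        mat_kernel A3 = {0\<^sub>v (length b3)} \<and>
        minimal_map A1 \<and> minimal_map A2 \<and> minimal_map A3)"

section \<open>Syzygy curves\<close>

definition reduced_curve :: "nat \<Rightarrow> poly3 \<Rightarrow> bool" where
  "reduced_curve d f \<longleftrightarrow> d \<ge> 1 \<and> homogeneous (int d) f \<and> squarefree f"

text \<open>The curve f = 0 of degree d is an m-syzygy curve with exponents ds = [d1, ..., dm].\<close>

definition syzygy_curve :: "nat \<Rightarrow> nat \<Rightarrow> nat list \<Rightarrow> poly3 \<Rightarrow> bool" where
  "syzygy_curve m d ds f \<longleftrightarrow> reduced_curve d f \<and>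
     m \<ge> 2 \<and> length ds = m \<and> sorted ds \<and> (\<forall>k\<in>set ds. 1 \<le> k) \<and>
     (\<exists>es. length es = m - 2 \<and> sorted es \<and>
        has_minimal_graded_free_resolution (jacobian_ideal f)
          (replicate 3 (int d - 1)) (map (\<lambda>k. int d - 1 + int k) ds) es)"

definition plus_one_generated :: "poly3 \<Rightarrow> bool" where
  "plus_one_generated f \<longleftrightarrow>
     (\<exists>d d1 d2 d3. syzygy_curve 3 d [d1, d2, d3] f \<and> d1 + d2 = d \<and> d3 > d2)"

section \<open>Lines and plane curves\<close>

text \<open>Points of the projective plane are given by nonzero vectors of homogeneous coordinates,
  and lines by nonzero vectors of coefficients. Two vectors give the same point
  (or the same line) iff they are related as follows.\<close>

definition proj_eq :: "complex ^ 3 \<Rightarrow> complex ^ 3 \<Rightarrow> bool" where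
  "proj_eq P Q \<longleftrightarrow> (\<exists>c. c \<noteq> 0 \<and> Q = c *s P)"

definition line_form :: "complex ^ 3 \<Rightarrow> poly3" where
  "line_form l = (\<Sum>i\<in>UNIV. const (l $h i) * var i)"

definition on_line :: "complex ^ 3 \<Rightarrow> complex ^ 3 \<Rightarrow> bool" where
  "on_line l P \<longleftrightarrow> (\<Sum>i\<in>UNIV. l $h i * P $h i) = 0"

text \<open>The univariate polynomial f(P + t Q) in t.\<close>

definition restrict_line :: "poly3 \<Rightarrow> complex ^ 3 \<Rightarrow> complex ^ 3 \<Rightarrow> complex poly" where
  "restrict_line f P Q = (\<Sum>m\<in>Poly_Mapping.keys f.
     Polynomial.smult (Poly_Mapping.lookup f m) (\<Prod>i\<in>UNIV. [:P $h i, Q $h i:] ^ Poly_Mapping.lookup m i))"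

text \<open>The line l is not contained in the curve f = 0 and cuts out on it the divisor that has
  coefficient D P at the point P. The intersection multiplicity at P is the order at
  t = 0 of f(P + t Q), where Q is a second point of the line; it does not depend on the choice
  of Q, nor on the coordinates chosen for P.\<close>

definition cuts_out :: "poly3 \<Rightarrow> complex ^ 3 \<Rightarrow> (complex ^ 3 \<Rightarrow> nat) \<Rightarrow> bool" where
  "cuts_out f l D \<longleftrightarrow>
     (\<forall>P Q. P \<noteq> 0 \<and> Q \<noteq> 0 \<and> on_line l P \<and> on_line l Q \<and> \<not> proj_eq P Q \<longrightarrow>
        restrict_line f P Q \<noteq> 0 \<and> Polynomial.order 0 (restrict_line f P Q) = D P)"

definition point_divisor :: "complex ^ 3 \<Rightarrow> complex ^ 3 \<Rightarrow> nat" where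
  "point_divisor P = (\<lambda>R. if proj_eq P R then 1 else 0)"

text \<open>P = P' is allowed, so hyperosculating lines are bitangents.\<close>

definition bitangent :: "poly3 \<Rightarrow> complex ^ 3 \<Rightarrow> bool" where
  "bitangent f l \<longleftrightarrow> l \<noteq> 0 \<and>
     (\<exists>P P'. P \<noteq> 0 \<and> P' \<noteq> 0 \<and> on_line l P \<and> on_line l P' \<and>
        cuts_out f l (\<lambda>R. 2 * point_divisor P R + 2 * point_divisor P' R))"

definition hyperosculating :: "poly3 \<Rightarrow> complex ^ 3 \<Rightarrow> bool" where
  "hyperosculating f l \<longleftrightarrow> l \<noteq> 0 \<and>
     (\<exists>P. P \<noteq> 0 \<and> on_line l P \<and> cuts_out f l (\<lambda>R. 4 * point_divisor P R))"

definition komiya_kuribayashi :: poly3 where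
  "komiya_kuribayashi =
     (let x = var 1; y = var 2; z = var 3
      in x ^ 4 + y ^ 4 + z ^ 4 + 3 * (x ^ 2 * y ^ 2 + x ^ 2 * z ^ 2 + y ^ 2 * z ^ 2))"

end

(* The 28 bitangents of the quartic are the 12 hyperosculating lines (2i : 1 : 1) up to signs and
   permutations, the 4 lines (1 : 1 : 1) up to signs, and 12 lines through the coordinate points.
   Up to the symmetries of the quartic, the only quadruple point that lies on two hyperosculating
   lines is (1 : -1 : 0), where x + y + 2iz, x + y - 2iz, x + y + z and x + y - z meet.
   In the coordinates s = x + y, d = x - y, t = 2z the arrangement has rational coefficients, and
   the resolution is explicit: there are two syzygies of degree 4 whose cross product is d/2 times
   the gradient. A product of linear forms in s and t lies in the jacobian ideal, hence every vector
   parallel to the gradient is a multiple of it (this also shows that the curve is reduced), so that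
   d times any syzygy is a combination of these two. Modulo d the two are dependent, with
   coprime coefficients 2(5s^2 + t^2) and -3st, which yields the third generator, of degree 5,
   and the only relation. *)

theory Submission
  imports Defs
begin

section \<open>Polynomials in three variables\<close>

text \<open>The hard point is exactness, and it rests on one regular sequence in the jacobian ideal:
  the binary form in s and t, and the sum of the s- and t-derivatives. The sum is used because the
  s-derivative is divisible by s and the t-derivative by t, so that each of them alone shares a
  factor with the binary form. Since that form splits into linear forms, regularity reduces to
  primality of linear forms and to one sample point per factor. The rest is cross products: two
  vectors orthogonal to the gradient have a cross product parallel to it, hence a polynomial
  multiple of it, and these multiples become the coefficients of a given syzygy. On the side of the
  lines, the quartic restricted to a bitangent is the square of a binary quadratic form, whose
  discriminant vanishes for a hyperosculating line. Comparing coefficients gives five equations, and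
  solving them yields necessary conditions that confine the lines to a finite list up to scaling.
  Concurrency is then a vanishing determinant.\<close>

lemma additive_keys_sum:
  fixes G :: "'b \<Rightarrow> 'c::comm_monoid_add \<Rightarrow> 'd::comm_monoid_add"
  assumes zero: "\<And>m. G m 0 = 0" and add: "\<And>m x y. G m (x + y) = G m x + G m y"
    and T: "\<And>p. T p = (\<Sum>m\<in>Poly_Mapping.keys p. G m (Poly_Mapping.lookup p m))"
  shows "T (p + q) = T p + T q"
proof -
  define A where "A = Poly_Mapping.keys p \<union> Poly_Mapping.keys q"
  have A: "T r = (\<Sum>m\<in>A. G m (Poly_Mapping.lookup r m))" if "Poly_Mapping.keys r \<subseteq> A" for r
    unfolding T using that
    by (intro sum.mono_neutral_left) (auto simp: A_def zero in_keys_iff)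
  show ?thesis
    using keys_add[of p q] by (simp add: A A_def lookup_add add sum.distrib)
qed

lemma keys_sum_single:
  assumes "\<And>m. G m 0 = 0"
  shows "(\<Sum>k\<in>Poly_Mapping.keys (Poly_Mapping.single m c).
           G k (Poly_Mapping.lookup (Poly_Mapping.single m c) k)) = G m c"
  using assms by (cases "c = 0") auto

lemma poly_mapping_sum_single:
  "p = (\<Sum>m\<in>Poly_Mapping.keys p. Poly_Mapping.single m (Poly_Mapping.lookup p m))"
  by (rule poly_mapping_eqI) (auto simp: lookup_sum lookup_single when_def in_keys_iff)

lemma poly_mapping_single_induct [case_names single plus]:
  fixes p :: "'a \<Rightarrow>\<^sub>0 'b::comm_monoid_add"
  assumes "\<And>m c. P (Poly_Mapping.single m c)" and "\<And>p q. P p \<Longrightarrow> P q \<Longrightarrow> P (p + q)"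
  shows "P p"
proof -
  have "P (\<Sum>m\<in>A. Poly_Mapping.single m (Poly_Mapping.lookup p m))" if "finite A" for A
    using that
  proof induction
    case empty
    show ?case using assms(1)[of undefined 0] by simp
  qed (auto intro: assms)
  then show ?thesis by (subst poly_mapping_sum_single) simp
qed

lemma const_simps:
  "const 0 = 0" "const 1 = 1" "const (x + y) = const x + const y" "const (x * y) = const x * const y"
  "const (- x) = - const x" "const (x - y) = const x - const y" "const (numeral n) = numeral n"
  by (simp_all add: const_def single_add mult_single single_uminus single_diff)

lemma var_power: "var i ^ n = Poly_Mapping.single (Poly_Mapping.single i n) 1"
  by (induction n) (simp_all add: var_def mult_single single_add[symmetric])

lemma exponent_decomposition:
  "m = Poly_Mapping.single 1 (Poly_Mapping.lookup m 1) + Poly_Mapping.single 2 (Poly_Mapping.lookup m 2)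
     + Poly_Mapping.single (3::3) (Poly_Mapping.lookup m 3 :: nat)"
proof (rule poly_mapping_eqI)
  fix i :: 3
  show "Poly_Mapping.lookup m i = Poly_Mapping.lookup (Poly_Mapping.single 1 (Poly_Mapping.lookup m 1)
    + Poly_Mapping.single 2 (Poly_Mapping.lookup m 2) + Poly_Mapping.single 3 (Poly_Mapping.lookup m 3)) i"
    using exhaust_3[of i] by (auto simp: lookup_add lookup_single)
qed

lemma single_eq_const_times_vars:
  "Poly_Mapping.single m c = const c * var 1 ^ Poly_Mapping.lookup m 1
     * var 2 ^ Poly_Mapping.lookup m 2 * var 3 ^ Poly_Mapping.lookup m 3"
  by (subst exponent_decomposition) (simp add: var_power const_def mult_single add.assoc)

lemma poly3_induct [case_names const var plus times]:
  assumes "\<And>c. P (const c)" and "\<And>i. P (var i)"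
    and "\<And>p q. P p \<Longrightarrow> P q \<Longrightarrow> P (p + q)" and times: "\<And>p q. P p \<Longrightarrow> P q \<Longrightarrow> P (p * q)"
  shows "P p"
proof (induction p rule: poly_mapping_single_induct)
  case (single m c)
  have pow: "P (var i ^ n)" for i n
    using assms(1)[of 1] assms(2) times by (induction n) (simp_all add: const_simps)
  show ?case
    by (subst single_eq_const_times_vars) (intro times pow assms(1))
qed (use assms(3) in auto)

subsection \<open>Evaluation\<close>

text \<open>The scalar map is a parameter because there are three instances: values at a point,
  restriction to a line (scalars become constant univariate polynomials), and substitution of
  polynomials for the variables.\<close>

definition eval3 :: "(complex \<Rightarrow> 'a::comm_ring_1) \<Rightarrow> (3 \<Rightarrow> 'a) \<Rightarrow> poly3 \<Rightarrow> 'a" where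
  "eval3 \<phi> a p = (\<Sum>m\<in>Poly_Mapping.keys p. \<phi> (Poly_Mapping.lookup p m) * (\<Prod>i\<in>UNIV. a i ^ Poly_Mapping.lookup m i))"

locale scalar_hom =
  fixes \<phi> :: "complex \<Rightarrow> 'a::comm_ring_1"
  assumes one: "\<phi> 1 = 1" and add: "\<phi> (x + y) = \<phi> x + \<phi> y" and mult: "\<phi> (x * y) = \<phi> x * \<phi> y"
begin

lemma zero: "\<phi> 0 = 0"
  using add[of 0 0] by simp

lemma eval3_add: "eval3 \<phi> a (p + q) = eval3 \<phi> a p + eval3 \<phi> a q"
  by (rule additive_keys_sum[where G = "\<lambda>m c. \<phi> c * (\<Prod>i\<in>UNIV. a i ^ Poly_Mapping.lookup m i)"])
    (simp_all add: zero add distrib_right eval3_def)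

lemma eval3_single:
  "eval3 \<phi> a (Poly_Mapping.single m c) = \<phi> c * (\<Prod>i\<in>UNIV. a i ^ Poly_Mapping.lookup m i)"
  unfolding eval3_def
  by (rule keys_sum_single[where G = "\<lambda>m c. \<phi> c * (\<Prod>i\<in>UNIV. a i ^ Poly_Mapping.lookup m i)"])
    (simp add: zero)

lemma eval3_mult: "eval3 \<phi> a (p * q) = eval3 \<phi> a p * eval3 \<phi> a q"
proof (induction p rule: poly_mapping_single_induct)
  case (single m c)
  show ?case
  proof (induction q rule: poly_mapping_single_induct)
    case (single n d)
    show ?case
      by (simp add: mult_single eval3_single mult lookup_add power_add prod.distrib mult_ac)
  qed (simp add: eval3_add distrib_left)
qed (simp add: eval3_add distrib_right)

lemma eval3_const: "eval3 \<phi> a (const c) = \<phi> c"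
  by (simp add: const_def eval3_single)

lemma eval3_var: "eval3 \<phi> a (var i) = a i"
proof -
  have "(\<Prod>j\<in>UNIV. a j ^ Poly_Mapping.lookup (Poly_Mapping.single i (1::nat)) j)
      = (\<Prod>j\<in>UNIV. if j = i then a i else 1)"
    by (rule prod.cong) (auto simp: lookup_single when_def)
  then show ?thesis by (simp add: var_def eval3_single one)
qed

lemma eval3_1: "eval3 \<phi> a 1 = 1"
  using eval3_const[of a 1] by (simp add: const_simps one)

lemma eval3_0: "eval3 \<phi> a 0 = 0"
  by (simp add: eval3_def)

lemma eval3_uminus: "eval3 \<phi> a (- p) = - eval3 \<phi> a p"
  using eval3_add[of a p "- p"] by (simp add: eval3_0 eq_neg_iff_add_eq_0 add.commute)

lemma eval3_diff: "eval3 \<phi> a (p - q) = eval3 \<phi> a p - eval3 \<phi> a q"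
  using eval3_add[of a p "- q"] by (simp add: eval3_uminus)

lemma eval3_power: "eval3 \<phi> a (p ^ n) = eval3 \<phi> a p ^ n"
  by (induction n) (simp_all add: eval3_1 eval3_mult)

lemma eval3_of_nat: "eval3 \<phi> a (of_nat n) = of_nat n"
  by (induction n) (simp_all add: eval3_0 eval3_1 eval3_add)

lemma eval3_numeral: "eval3 \<phi> a (numeral n) = numeral n"
  using eval3_of_nat[of a "numeral n"] by simp

lemma eval3_line_form: "eval3 \<phi> a (line_form l) = (\<Sum>i\<in>UNIV. \<phi> (l $h i) * a i)"
  by (simp add: line_form_def sum_3 eval3_add eval3_mult eval3_const eval3_var)

lemmas eval3_simps = eval3_add eval3_mult eval3_const eval3_var eval3_1 eval3_0 eval3_uminus
  eval3_diff eval3_power eval3_numeral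

end

interpretation to_complex: scalar_hom "\<lambda>c. c"
  by unfold_locales auto

interpretation to_poly: scalar_hom "\<lambda>c::complex. [:c:]"
  by unfold_locales auto

interpretation to_poly3: scalar_hom const
  by unfold_locales (auto simp: const_simps)

lemma restrict_line_eq_eval3: "restrict_line f P Q = eval3 (\<lambda>c. [:c:]) (\<lambda>i. [:P $h i, Q $h i:]) f"
  by (simp add: restrict_line_def eval3_def)

subsection \<open>Partial derivatives\<close>

lemma partial_deriv_add: "partial_deriv i (p + q) = partial_deriv i p + partial_deriv i q"
  by (rule additive_keys_sum[where G = "\<lambda>m c. Poly_Mapping.single (m - Poly_Mapping.single i 1)
       (of_nat (Poly_Mapping.lookup m i) * c)"])
    (simp_all add: partial_deriv_def distrib_left single_add)

lemma partial_deriv_single: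
  "partial_deriv i (Poly_Mapping.single m c)
     = Poly_Mapping.single (m - Poly_Mapping.single i 1) (of_nat (Poly_Mapping.lookup m i) * c)"
  unfolding partial_deriv_def
  by (rule keys_sum_single[where G = "\<lambda>m c. Poly_Mapping.single (m - Poly_Mapping.single i 1)
       (of_nat (Poly_Mapping.lookup m i) * c)"]) simp

lemma partial_deriv_mult:
  "partial_deriv i (p * q) = partial_deriv i p * q + p * partial_deriv i q"
proof (induction p rule: poly_mapping_single_induct)
  case (single m c)
  show ?case
  proof (induction q rule: poly_mapping_single_induct)
    case (single n d)
    let ?e = "Poly_Mapping.single i (1::nat)"
    \<comment> \<open>Truncated subtraction commutes with addition only where the exponent is
      positive; where it is zero, the coefficient vanishes.\<close>
    have shift: "k - ?e + l = k + l - ?e" if "Poly_Mapping.lookup k i \<noteq> 0" for k l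
      using that by (intro poly_mapping_eqI) (auto simp: lookup_add lookup_minus lookup_single when_def)
    have "Poly_Mapping.single (k - ?e + l) (of_nat (Poly_Mapping.lookup k i) * x)
        = Poly_Mapping.single (k + l - ?e) (of_nat (Poly_Mapping.lookup k i) * x)" for k l and x :: complex
      using shift by (cases "Poly_Mapping.lookup k i = 0") auto
    from this[of m n "c * d"] this[of n m "c * d"] show ?case
      by (simp add: mult_single partial_deriv_single lookup_add single_add[symmetric] algebra_simps)
  qed (simp add: partial_deriv_add algebra_simps)
qed (simp add: partial_deriv_add algebra_simps)

lemma partial_deriv_const: "partial_deriv i (const c) = 0"
  by (simp add: const_def partial_deriv_single)

lemma partial_deriv_var: "partial_deriv i (var j) = (if i = j then 1 else 0)"
  by (auto simp: var_def partial_deriv_single lookup_single)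

lemma partial_deriv_1: "partial_deriv i 1 = 0"
  using partial_deriv_const[of i 1] by (simp add: const_simps)

lemma partial_deriv_numeral: "partial_deriv i (numeral n) = 0"
  using partial_deriv_const[of i "numeral n"] by (simp add: const_simps)

lemma partial_deriv_uminus: "partial_deriv i (- p) = - partial_deriv i p"
  using partial_deriv_add[of i p "- p"]
  by (simp add: partial_deriv_def[of i 0] eq_neg_iff_add_eq_0 add.commute)

lemma partial_deriv_diff: "partial_deriv i (p - q) = partial_deriv i p - partial_deriv i q"
  using partial_deriv_add[of i p "- q"] by (simp add: partial_deriv_uminus)

lemma partial_deriv_line_form: "partial_deriv i (line_form l) = const (l $h i)"
  using exhaust_3[of i]
  by (auto simp: line_form_def sum_3 partial_deriv_add partial_deriv_mult partial_deriv_const partial_deriv_var)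

subsection \<open>Homogeneous polynomials\<close>

lemma mdeg_add: "mdeg (m + n) = mdeg m + mdeg n"
  by (simp add: mdeg_def lookup_add sum.distrib)

lemma homogeneous_add: "homogeneous k p \<Longrightarrow> homogeneous k q \<Longrightarrow> homogeneous k (p + q)"
  using keys_add[of p q] by (auto simp: homogeneous_def)

lemma homogeneous_uminus: "homogeneous k p \<Longrightarrow> homogeneous k (- p)"
  by (auto simp: homogeneous_def in_keys_iff)

lemma homogeneous_diff: "homogeneous k p \<Longrightarrow> homogeneous k q \<Longrightarrow> homogeneous k (p - q)"
  using homogeneous_add[of k p "- q"] by (simp add: homogeneous_uminus)

lemma homogeneous_mult: "homogeneous k p \<Longrightarrow> homogeneous l q \<Longrightarrow> homogeneous (k + l) (p * q)"
  using keys_mult[of p q] by (fastforce simp: homogeneous_def mdeg_add)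

lemma homogeneous_const: "homogeneous 0 (const c)"
  by (auto simp: homogeneous_def const_def mdeg_def split: if_splits)

lemma homogeneous_1: "homogeneous 0 1"
  using homogeneous_const[of 1] by (simp add: const_simps)

lemma homogeneous_numeral: "homogeneous 0 (numeral n)"
  using homogeneous_const[of "numeral n"] by (simp add: const_simps)

lemma homogeneous_power: "homogeneous k p \<Longrightarrow> homogeneous (int n * k) (p ^ n)"
proof (induction n)
  case (Suc n)
  then show ?case
    using homogeneous_mult[of k p "int n * k" "p ^ n"] by (simp add: algebra_simps)
qed (simp add: homogeneous_1)

lemma homogeneous_var: "homogeneous 1 (var i)"
  by (simp add: homogeneous_def var_def mdeg_def lookup_single when_def)

lemma homogeneous_line_form: "homogeneous 1 (line_form l)"
  using homogeneous_mult[OF homogeneous_const homogeneous_var]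
  by (simp add: line_form_def sum_3 homogeneous_add)

lemma lookup_0_homogeneous: "homogeneous k p \<Longrightarrow> k \<noteq> 0 \<Longrightarrow> Poly_Mapping.lookup p 0 = 0"
  by (force simp: homogeneous_def mdeg_def in_keys_iff)

subsection \<open>Linear forms\<close>

definition pairing :: "complex ^ 3 \<Rightarrow> complex ^ 3 \<Rightarrow> complex" where
  "pairing l v = (\<Sum>i\<in>UNIV. l $h i * v $h i)"

lemma pairing_simps:
  "pairing (l + m) v = pairing l v + pairing m v" "pairing (l - m) v = pairing l v - pairing m v"
  "pairing (c *s l) v = c * pairing l v"
  "pairing l (v + w) = pairing l v + pairing l w" "pairing l (v - w) = pairing l v - pairing l w"
  "pairing l (c *s v) = c * pairing l v"
  by (simp_all add: pairing_def sum_3 algebra_simps)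

lemma line_form_simps:
  "line_form (l + m) = line_form l + line_form m" "line_form (l - m) = line_form l - line_form m"
  "line_form (c *s l) = const c * line_form l"
  by (simp_all add: line_form_def sum_3 const_simps algebra_simps)

text \<open>The substitution that fixes the linear forms vanishing at v and, when the pairing of
  l and v is 1, maps l to 0.\<close>

definition project_along :: "complex ^ 3 \<Rightarrow> complex ^ 3 \<Rightarrow> poly3 \<Rightarrow> poly3" where
  "project_along l v = eval3 const (\<lambda>i. var i - const (v $h i) * line_form l)"

lemmas project_along_simps = to_poly3.eval3_simps[where a = "\<lambda>i. var i - const (v $h i) * line_form l" for l v,
    folded project_along_def]

lemma project_along_line_form:
  "project_along l v (line_form m) = line_form m - const (pairing m v) * line_form l"
proof -
  have "project_along l v (line_form m) = (\<Sum>i\<in>UNIV. const (m $h i) * (var i - const (v $h i) * line_form l))"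
    by (simp add: project_along_def to_poly3.eval3_line_form)
  also have "\<dots> = line_form m - const (pairing m v) * line_form l"
    unfolding line_form_def[of m] pairing_def by (simp add: sum_3 const_simps algebra_simps)
  finally show ?thesis .
qed

text \<open>The substitution moves each variable by a multiple of \<open>line_form l\<close>, and
  congruence modulo \<open>line_form l\<close> is preserved by sums and products.\<close>

lemma line_form_dvd_diff_project_along: "line_form l dvd p - project_along l v p"
proof (induction p rule: poly3_induct)
  case (const c)
  then show ?case by (simp add: project_along_simps)
next
  case (var i)
  then show ?case by (simp add: project_along_simps)
next
  case (plus p q)
  have "p + q - project_along l v (p + q) = (p - project_along l v p) + (q - project_along l v q)"
    by (simp add: project_along_simps)
  then show ?case using plus by (metis dvd_add)
next
  case (times p q)
  have "p * q - project_along l v (p * q)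
      = (p - project_along l v p) * q + (q - project_along l v q) * project_along l v p"
    by (simp add: project_along_simps algebra_simps)
  then show ?case using times by (metis dvd_add dvd_mult2)
qed

lemma project_along_eq_0_imp_dvd: "project_along l v p = 0 \<Longrightarrow> line_form l dvd p"
  using line_form_dvd_diff_project_along[of l p v] by simp

text \<open>\<open>project_along l v\<close> is a ring endomorphism of a domain, and its kernel
  consists exactly of the multiples of \<open>line_form l\<close>; such a kernel is a prime
  ideal.\<close>

lemma prime_elem_line_form:
  assumes lv: "pairing l v = 1"
  shows "prime_elem (line_form l)"
proof -
  have l0: "project_along l v (line_form l) = 0"
    by (simp add: project_along_line_form lv const_simps)
  have nz: "line_form l \<noteq> 0"
  proof
    assume "line_form l = 0"
    then have "const (l $h i) = 0" for i
      using partial_deriv_line_form[of i l] partial_deriv_const[of i 0] by (simp add: const_simps)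
    then have "l $h i = 0" for i
      unfolding const_def by (metis lookup_single_eq lookup_zero)
    then show False using lv by (simp add: pairing_def)
  qed
  have zero: "project_along l v x = 0 \<longleftrightarrow> line_form l dvd x" for x
  proof
    assume "line_form l dvd x"
    then obtain y where "x = line_form l * y" by (elim dvdE)
    then show "project_along l v x = 0" by (simp add: project_along_simps l0)
  qed (rule project_along_eq_0_imp_dvd)
  show ?thesis
    unfolding prime_elem_def zero[symmetric] using nz by (auto simp: project_along_simps)
qed

lemma not_line_form_dvd:
  assumes "pairing l u = 0" and "eval3 (\<lambda>c. c) (($h) u) p \<noteq> 0"
  shows "\<not> line_form l dvd p"
proof
  assume "line_form l dvd p"
  then obtain q where "p = line_form l * q" by (elim dvdE)
  then show False
    using assms by (simp add: to_complex.eval3_mult to_complex.eval3_line_form pairing_def)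
qed

section \<open>Exactness criteria\<close>

lemma index_mult_mat_vec_sum:
  "i < n \<Longrightarrow> v \<in> carrier_vec m \<Longrightarrow> (Matrix.mat n m f *\<^sub>v v) $ i = (\<Sum>j<m. f (i, j) * v $ j)"
  by (auto simp: scalar_prod_def lessThan_atLeast0 intro!: sum.cong)

text \<open>Matrices are replaced by finite sums, for a last module of rank one. The inequalities
  between degrees yield minimality, since a homogeneous entry of nonzero degree has no constant
  term; over a domain a single nonzero entry of \<open>K\<close> makes the last map
  injective.\<close>

lemma has_minimal_graded_free_resolutionI:
  fixes F K :: "nat \<Rightarrow> poly3" and M :: "nat \<Rightarrow> nat \<Rightarrow> poly3"
  assumes len: "length b1 = n" "length b2 = m" "length b3 = 1"
    and F: "\<And>j. j < n \<Longrightarrow> homogeneous (b1 ! j) (F j) \<and> b1 ! j \<noteq> 0"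
    and M: "\<And>i j. i < n \<Longrightarrow> j < m \<Longrightarrow> homogeneous (b2 ! j - b1 ! i) (M i j) \<and> b2 ! j \<noteq> b1 ! i"
    and K: "\<And>j. j < m \<Longrightarrow> homogeneous (b3 ! 0 - b2 ! j) (K j) \<and> b3 ! 0 \<noteq> b2 ! j"
    and I: "I = {(\<Sum>j<n. F j * g j) | g. True}"
    and FM: "\<And>j. j < m \<Longrightarrow> (\<Sum>i<n. F i * M i j) = 0"
    and exact1: "\<And>u. (\<Sum>i<n. F i * u i) = 0 \<Longrightarrow> \<exists>x. \<forall>i<n. u i = (\<Sum>j<m. M i j * x j)"
    and MK: "\<And>i. i < n \<Longrightarrow> (\<Sum>j<m. M i j * K j) = 0"
    and exact2: "\<And>x. (\<And>i. i < n \<Longrightarrow> (\<Sum>j<m. M i j * x j) = 0) \<Longrightarrow> \<exists>k. \<forall>j<m. x j = K j * k"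
    and K_nz: "j0 < m" "K j0 \<noteq> 0"
  shows "has_minimal_graded_free_resolution I b1 b2 b3"
proof -
  define A1 where "A1 = Matrix.mat 1 n (\<lambda>(i, j). F j)"
  define A2 where "A2 = Matrix.mat n m (\<lambda>(i, j). M i j)"
  define A3 where "A3 = Matrix.mat m 1 (\<lambda>(i, j). K i)"
  have A1: "(A1 *\<^sub>v v) $ 0 = (\<Sum>j<n. F j * v $ j)" if "v \<in> carrier_vec n" for v
    using index_mult_mat_vec_sum[of 0 1 v n "\<lambda>(i, j). F j"] that by (simp add: A1_def)
  have A2: "(A2 *\<^sub>v v) $ i = (\<Sum>j<m. M i j * v $ j)" if "v \<in> carrier_vec m" "i < n" for v i
    using index_mult_mat_vec_sum[of i n v m "\<lambda>(i, j). M i j"] that by (simp add: A2_def)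
  have A3: "(A3 *\<^sub>v v) $ i = K i * v $ 0" if "v \<in> carrier_vec 1" "i < m" for v i
    using index_mult_mat_vec_sum[of i m v 1 "\<lambda>(i, j). K i"] that by (simp add: A3_def)
  have dims: "dim_row A1 = 1" "dim_col A1 = n" "dim_row A2 = n" "dim_col A2 = m"
    "dim_row A3 = m" "dim_col A3 = 1"
    by (simp_all add: A1_def A2_def A3_def)
  have "mat_image A1 = (\<lambda>p. Matrix.vec 1 (\<lambda>_. p)) ` I"
  proof (intro equalityI subsetI)
    fix w assume "w \<in> mat_image A1"
    then obtain v where v: "v \<in> carrier_vec n" "w = A1 *\<^sub>v v" by (auto simp: mat_image_def dims)
    have "w = Matrix.vec 1 (\<lambda>_. \<Sum>j<n. F j * v $ j)"
      using A1[OF v(1)] by (intro eq_vecI) (auto simp: v dims simp del: index_mult_mat_vec)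
    then show "w \<in> (\<lambda>p. Matrix.vec 1 (\<lambda>_. p)) ` I" by (auto simp: I)
  next
    fix w assume "w \<in> (\<lambda>p. Matrix.vec 1 (\<lambda>_. p)) ` I"
    then obtain g where g: "w = Matrix.vec 1 (\<lambda>_. \<Sum>j<n. F j * g j)" by (auto simp: I)
    define v where "v = Matrix.vec n g"
    have "w = A1 *\<^sub>v v"
      using A1[of v] by (intro eq_vecI) (auto simp: v_def g dims simp del: index_mult_mat_vec)
    then show "w \<in> mat_image A1" by (auto simp: mat_image_def dims v_def)
  qed
  moreover have "mat_kernel A1 = mat_image A2"
  proof (intro equalityI subsetI)
    fix v assume "v \<in> mat_kernel A1"
    then have v: "v \<in> carrier_vec n" "A1 *\<^sub>v v = 0\<^sub>v 1" by (auto simp: mat_kernel_def dims)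
    then have "(\<Sum>j<n. F j * v $ j) = 0" using A1[OF v(1)] by simp
    then obtain x where x: "\<forall>i<n. v $ i = (\<Sum>j<m. M i j * x j)" using exact1 by blast
    have "v = A2 *\<^sub>v Matrix.vec m x"
      using v(1) x by (intro eq_vecI) (auto simp: dims A2 simp del: index_mult_mat_vec)
    then show "v \<in> mat_image A2" by (auto simp: mat_image_def dims)
  next
    fix v assume "v \<in> mat_image A2"
    then obtain x where x: "x \<in> carrier_vec m" "v = A2 *\<^sub>v x" by (auto simp: mat_image_def dims)
    then have v: "v \<in> carrier_vec n" by (intro carrier_vecI) (simp add: dims)
    have "(\<Sum>i<n. F i * v $ i) = (\<Sum>i<n. \<Sum>j<m. F i * M i j * x $ j)"
      by (simp add: x A2 sum_distrib_left mult.assoc del: index_mult_mat_vec)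
    also have "\<dots> = (\<Sum>j<m. (\<Sum>i<n. F i * M i j) * x $ j)"
      by (subst sum.swap) (simp add: sum_distrib_right)
    also have "\<dots> = 0" by (simp add: FM)
    finally have "A1 *\<^sub>v v = 0\<^sub>v 1" using A1[OF v] by (intro eq_vecI) (auto simp: dims simp del: index_mult_mat_vec)
    then show "v \<in> mat_kernel A1" using v by (auto simp: mat_kernel_def dims)
  qed
  moreover have "mat_kernel A2 = mat_image A3"
  proof (intro equalityI subsetI)
    fix v assume "v \<in> mat_kernel A2"
    then have v: "v \<in> carrier_vec m" "A2 *\<^sub>v v = 0\<^sub>v n" by (auto simp: mat_kernel_def dims)
    then have "(\<Sum>j<m. M i j * v $ j) = 0" if "i < n" for i using A2[OF v(1) that] that by simp
    then obtain k where k: "\<forall>j<m. v $ j = K j * k" using exact2[of "\<lambda>j. v $ j"] by blast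
    have "v = A3 *\<^sub>v Matrix.vec 1 (\<lambda>_. k)"
      using v(1) k by (intro eq_vecI) (auto simp: dims A3 simp del: index_mult_mat_vec)
    then show "v \<in> mat_image A3" by (auto simp: mat_image_def dims)
  next
    fix v assume "v \<in> mat_image A3"
    then obtain x where x: "x \<in> carrier_vec 1" "v = A3 *\<^sub>v x" by (auto simp: mat_image_def dims)
    then have v: "v \<in> carrier_vec m" by (intro carrier_vecI) (simp add: dims)
    have "(\<Sum>j<m. M i j * v $ j) = 0" if "i < n" for i
    proof -
      have "(\<Sum>j<m. M i j * v $ j) = (\<Sum>j<m. M i j * K j) * x $ 0"
        using x(1) by (simp add: x(2) A3 sum_distrib_right mult.assoc del: index_mult_mat_vec One_nat_def)
      then show ?thesis using MK that by simp
    qed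
    then have "A2 *\<^sub>v v = 0\<^sub>v n" using A2[OF v] by (intro eq_vecI) (auto simp: dims simp del: index_mult_mat_vec)
    then show "v \<in> mat_kernel A2" using v by (auto simp: mat_kernel_def dims)
  qed
  moreover have "mat_kernel A3 = {0\<^sub>v (length b3)}"
  proof (intro equalityI subsetI)
    fix v assume "v \<in> mat_kernel A3"
    then have v: "v \<in> carrier_vec 1" "A3 *\<^sub>v v = 0\<^sub>v m" by (auto simp: mat_kernel_def dims)
    then have "K j0 * v $ 0 = 0" using A3[OF v(1) K_nz(1)] K_nz by simp
    then have "v $ 0 = 0" using K_nz by simp
    then have "v = 0\<^sub>v 1" using v(1) by (intro eq_vecI) auto
    then show "v \<in> {0\<^sub>v (length b3)}" by (simp add: len)
  next
    fix v :: "poly3 Matrix.vec" assume "v \<in> {0\<^sub>v (length b3)}"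
    then have v: "v = 0\<^sub>v 1" by (simp add: len)
    have "A3 *\<^sub>v v = 0\<^sub>v m" using A3[of v] by (intro eq_vecI) (auto simp: v dims simp del: index_mult_mat_vec)
    then show "v \<in> mat_kernel A3" by (auto simp: mat_kernel_def dims v)
  qed
  moreover have "graded_map [0] b1 A1" using F by (simp add: graded_map_def A1_def len)
  moreover have "graded_map b1 b2 A2" using M by (simp add: graded_map_def A2_def len)
  moreover have "graded_map b2 b3 A3" using K by (simp add: graded_map_def A3_def len)
  moreover have "minimal_map A1"
    using F lookup_0_homogeneous[OF conjunct1[OF F]] by (simp add: minimal_map_def A1_def)
  moreover have "minimal_map A2"
    using M lookup_0_homogeneous[OF conjunct1[OF M]] by (simp add: minimal_map_def A2_def)
  moreover have "minimal_map A3"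
    using K lookup_0_homogeneous[OF conjunct1[OF K]] by (simp add: minimal_map_def A3_def)
  ultimately show ?thesis unfolding has_minimal_graded_free_resolution_def by blast
qed

text \<open>This expands the triple product of u, v and F: two vectors orthogonal to F have a cross
  product parallel to F. The equations have the shape of the premises of
  \<open>parallel_to_gradient\<close>.\<close>

lemma cross_product_of_syzygies_parallel:
  fixes F1 F2 F3 :: "'a::comm_ring_1"
  assumes u: "F1 * u1 + F2 * u2 + F3 * u3 = 0" and v: "F1 * v1 + F2 * v2 + F3 * v3 = 0"
  shows "(u2 * v3 - u3 * v2) * F2 = (u3 * v1 - u1 * v3) * F1"
    and "(u2 * v3 - u3 * v2) * F3 = (u1 * v2 - u2 * v1) * F1"
proof -
  have "(u2 * v3 - u3 * v2) * F2 - (u3 * v1 - u1 * v3) * F1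
      = v3 * (F1 * u1 + F2 * u2 + F3 * u3) - u3 * (F1 * v1 + F2 * v2 + F3 * v3)"
    by (simp add: algebra_simps)
  then show "(u2 * v3 - u3 * v2) * F2 = (u3 * v1 - u1 * v3) * F1" using u v by simp
  have "(u2 * v3 - u3 * v2) * F3 - (u1 * v2 - u2 * v1) * F1
      = u2 * (F1 * v1 + F2 * v2 + F3 * v3) - v2 * (F1 * u1 + F2 * u2 + F3 * u3)"
    by (simp add: algebra_simps)
  then show "(u2 * v3 - u3 * v2) * F3 = (u1 * v2 - u2 * v1) * F1" using u v by simp
qed

text \<open>The nonzero minor makes p and q independent over the fraction field, so only 0 is
  parallel to both. Multiplying by the minor keeps the argument inside the domain.\<close>

lemma eq_0_if_parallel_to_independent:
  fixes v1 v2 v3 :: "'a::idom"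
  assumes p: "v2 * p3 = v3 * p2" "v3 * p1 = v1 * p3" "v1 * p2 = v2 * p1"
    and q: "v2 * q3 = v3 * q2" "v3 * q1 = v1 * q3" "v1 * q2 = v2 * q1"
    and n: "p1 * q2 - p2 * q1 \<noteq> 0"
  shows "v1 = 0" "v2 = 0" "v3 = 0"
proof -
  have "(p1 * q2 - p2 * q1) * v1 = p1 * (v1 * q2 - v2 * q1) - q1 * (v1 * p2 - v2 * p1)"
    "(p1 * q2 - p2 * q1) * v2 = p2 * (v1 * q2 - v2 * q1) - q2 * (v1 * p2 - v2 * p1)"
    "(p1 * q2 - p2 * q1) * v3 = q3 * (v2 * p1 - v1 * p2) + p1 * (v3 * q2 - v2 * q3) - p2 * (v3 * q1 - v1 * q3)"
    by (simp_all add: algebra_simps)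
  then show "v1 = 0" "v2 = 0" "v3 = 0" using n by (simp_all add: p q)
qed

text \<open>The coefficients are dictated by cross products: the difference v of the two sides has
  cross product \<open>h * c * F - c * h * F = 0\<close> with p, and likewise 0 with q, so it
  vanishes.\<close>

lemma multiple_of_syzygy_combination:
  fixes F1 F2 F3 :: "'a::idom"
  assumes p: "u2 * p3 - u3 * p2 = c * F1" "u3 * p1 - u1 * p3 = c * F2" "u1 * p2 - u2 * p1 = c * F3"
    and q: "u2 * q3 - u3 * q2 = e * F1" "u3 * q1 - u1 * q3 = e * F2" "u1 * q2 - u2 * q1 = e * F3"
    and n: "2 * (p2 * q3 - p3 * q2) = h * F1" "2 * (p3 * q1 - p1 * q3) = h * F2"
      "2 * (p1 * q2 - p2 * q1) = h * F3" and nz: "h \<noteq> 0" "F3 \<noteq> 0"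
  shows "h * u1 = 2 * e * p1 - 2 * c * q1 \<and> h * u2 = 2 * e * p2 - 2 * c * q2
    \<and> h * u3 = 2 * e * p3 - 2 * c * q3"
proof -
  define v1 v2 v3 where "v1 = h * u1 - (2 * e * p1 - 2 * c * q1)"
    and "v2 = h * u2 - (2 * e * p2 - 2 * c * q2)" and "v3 = h * u3 - (2 * e * p3 - 2 * c * q3)"
  note v = v1_def v2_def v3_def
  have "v2 * p3 - v3 * p2 = h * (u2 * p3 - u3 * p2) - c * (2 * (p2 * q3 - p3 * q2))"
    "v3 * p1 - v1 * p3 = h * (u3 * p1 - u1 * p3) - c * (2 * (p3 * q1 - p1 * q3))"
    "v1 * p2 - v2 * p1 = h * (u1 * p2 - u2 * p1) - c * (2 * (p1 * q2 - p2 * q1))"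
    "v2 * q3 - v3 * q2 = h * (u2 * q3 - u3 * q2) - e * (2 * (p2 * q3 - p3 * q2))"
    "v3 * q1 - v1 * q3 = h * (u3 * q1 - u1 * q3) - e * (2 * (p3 * q1 - p1 * q3))"
    "v1 * q2 - v2 * q1 = h * (u1 * q2 - u2 * q1) - e * (2 * (p1 * q2 - p2 * q1))"
    by (simp_all add: v algebra_simps)
  then have par: "v2 * p3 = v3 * p2" "v3 * p1 = v1 * p3" "v1 * p2 = v2 * p1"
    "v2 * q3 = v3 * q2" "v3 * q1 = v1 * q3" "v1 * q2 = v2 * q1"
    unfolding p q n by simp_all
  have "p1 * q2 - p2 * q1 \<noteq> 0" using n(3) nz by (metis mult_eq_0_iff)
  from eq_0_if_parallel_to_independent[OF par this] show ?thesis unfolding v by simp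
qed

text \<open>Multiplication by g is injective modulo e, that is, e and g behave like a regular
  sequence. This form of coprimality passes to products of the second argument and holds for prime
  elements that do not divide g.\<close>

definition cancels :: "'a::idom \<Rightarrow> 'a \<Rightarrow> bool" where
  "cancels g e \<longleftrightarrow> e \<noteq> 0 \<and> (\<forall>w. e dvd w * g \<longrightarrow> e dvd w)"

lemma cancels_prime: "prime_elem p \<Longrightarrow> \<not> p dvd g \<Longrightarrow> cancels g p"
  by (auto simp: cancels_def prime_elem_dvd_mult_iff)

lemma cancelsD:
  assumes "cancels g e"
  shows "e \<noteq> 0" and "e dvd w * g \<Longrightarrow> e dvd w"
  using assms by (simp_all only: cancels_def not_False_eq_True)

lemma cancels_mult:
  assumes "cancels g e" and "cancels g f"
  shows "cancels g (e * f)"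
  unfolding cancels_def
proof (intro conjI allI impI)
  show "e * f \<noteq> 0" using cancelsD(1)[OF assms(1)] cancelsD(1)[OF assms(2)] by simp
  fix w assume ef: "e * f dvd w * g"
  have "e dvd w" by (rule cancelsD(2)[OF assms(1) dvd_mult_left[OF ef]])
  then obtain w' where w': "w = e * w'" by (elim dvdE)
  then have "f dvd w' * g" using ef cancelsD(1)[OF assms(1)] by (simp add: mult.assoc)
  then have "f dvd w'" by (rule cancelsD(2)[OF assms(2)])
  then show "e * f dvd w" by (simp add: w')
qed

section \<open>The arrangement in adapted coordinates\<close>

text \<open>Up to a constant factor this is the union of the quartic and the lines x + y + 2 i z,
  x + y - 2 i z, x + y + z and x + y - z, written in s = x + y, d = x - y, t = 2 z.\<close>

definition arr :: "'a::comm_ring_1 \<Rightarrow> 'a \<Rightarrow> 'a \<Rightarrow> 'a" where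
  "arr s d t = (5 * s ^ 4 + 5 * d ^ 4 + t ^ 4 + 6 * s ^ 2 * d ^ 2 + 6 * t ^ 2 * s ^ 2 + 6 * t ^ 2 * d ^ 2)
     * (4 * s ^ 2 - t ^ 2) * (s ^ 2 + t ^ 2)"

text \<open>The last factor is the s-derivative of the expanded product of lines
  \<open>4 * s ^ 4 + 3 * s ^ 2 * t ^ 2 - t ^ 4\<close>. The partials are formulas over any ring so
  that they apply to polynomials and to sample points alike; \<open>partial_deriv_arr\<close> ties
  them to the actual derivatives.\<close>

definition arr_s :: "'a::comm_ring_1 \<Rightarrow> 'a \<Rightarrow> 'a \<Rightarrow> 'a" where
  "arr_s s d t = (20 * s ^ 3 + 12 * s * d ^ 2 + 12 * s * t ^ 2) * (4 * s ^ 2 - t ^ 2) * (s ^ 2 + t ^ 2)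
     + (5 * s ^ 4 + 5 * d ^ 4 + t ^ 4 + 6 * s ^ 2 * d ^ 2 + 6 * t ^ 2 * s ^ 2 + 6 * t ^ 2 * d ^ 2)
     * (16 * s ^ 3 + 6 * s * t ^ 2)"

definition arr_d :: "'a::comm_ring_1 \<Rightarrow> 'a \<Rightarrow> 'a \<Rightarrow> 'a" where
  "arr_d s d t = (20 * d ^ 3 + 12 * d * s ^ 2 + 12 * d * t ^ 2) * (4 * s ^ 2 - t ^ 2) * (s ^ 2 + t ^ 2)"

definition arr_t :: "'a::comm_ring_1 \<Rightarrow> 'a \<Rightarrow> 'a \<Rightarrow> 'a" where
  "arr_t s d t = (4 * t ^ 3 + 12 * t * s ^ 2 + 12 * t * d ^ 2) * (4 * s ^ 2 - t ^ 2) * (s ^ 2 + t ^ 2)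
     + (5 * s ^ 4 + 5 * d ^ 4 + t ^ 4 + 6 * s ^ 2 * d ^ 2 + 6 * t ^ 2 * s ^ 2 + 6 * t ^ 2 * d ^ 2)
     * (6 * s ^ 2 * t - 4 * t ^ 3)"

lemmas arr_partials = arr_s_def arr_d_def arr_t_def

text \<open>The first index is the component along s, d, t; the second selects the syzygy. Let K be
  the quartic factor, L the product of the lines and E = 5d^2 + 3s^2 + 3t^2, so that the
  d-derivative of K L is 4 d E L. Column 0 is the cross product of the gradients of K and L divided
  by -8E, so it annihilates K and L separately. Column 1 is Euler's formula for K L multiplied by d
  E: the term 8 d E K L equals 2 K times the d-derivative, so everything moves into the middle
  component -(2K - d^2 E).\<close>

definition syz :: "'a::comm_ring_1 \<Rightarrow> 'a \<Rightarrow> 'a \<Rightarrow> nat \<Rightarrow> nat \<Rightarrow> 'a" where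
  "syz s d t i j =
     [[2 * d * t ^ 3 - 3 * s ^ 2 * d * t,
       3 * s ^ 3 * d + 5 * s * d ^ 3 + 3 * s * d * t ^ 2,
       4 * t ^ 5 + 5 * s ^ 2 * t ^ 3 - 39 * s ^ 4 * t - 15 * s ^ 2 * d ^ 2 * t],
      [- 3 * s ^ 3 * t - 3 * s * t ^ 3,
       - (10 * s ^ 4 + 9 * s ^ 2 * d ^ 2 + 12 * s ^ 2 * t ^ 2 + 5 * d ^ 4 + 9 * d ^ 2 * t ^ 2 + 2 * t ^ 4),
       27 * s ^ 3 * t * d + 15 * s * t * d ^ 3 + 27 * s * t ^ 3 * d],
      [8 * s ^ 3 * d + 3 * s * d * t ^ 2,
       3 * s ^ 2 * d * t + 5 * d ^ 3 * t + 3 * d * t ^ 3,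
       80 * s ^ 5 + 37 * s ^ 3 * t ^ 2 - 3 * s * t ^ 4 - 15 * s * d ^ 2 * t ^ 2]] ! i ! j"

lemma syz_entries:
  "syz s d t 0 0 = 2 * d * t ^ 3 - 3 * s ^ 2 * d * t"
  "syz s d t 0 1 = 3 * s ^ 3 * d + 5 * s * d ^ 3 + 3 * s * d * t ^ 2"
  "syz s d t 0 2 = 4 * t ^ 5 + 5 * s ^ 2 * t ^ 3 - 39 * s ^ 4 * t - 15 * s ^ 2 * d ^ 2 * t"
  "syz s d t 1 0 = - 3 * s ^ 3 * t - 3 * s * t ^ 3"
  "syz s d t 1 1 = - (10 * s ^ 4 + 9 * s ^ 2 * d ^ 2 + 12 * s ^ 2 * t ^ 2 + 5 * d ^ 4 + 9 * d ^ 2 * t ^ 2 + 2 * t ^ 4)"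
  "syz s d t 1 2 = 27 * s ^ 3 * t * d + 15 * s * t * d ^ 3 + 27 * s * t ^ 3 * d"
  "syz s d t 2 0 = 8 * s ^ 3 * d + 3 * s * d * t ^ 2"
  "syz s d t 2 1 = 3 * s ^ 2 * d * t + 5 * d ^ 3 * t + 3 * d * t ^ 3"
  "syz s d t 2 2 = 80 * s ^ 5 + 37 * s ^ 3 * t ^ 2 - 3 * s * t ^ 4 - 15 * s * d ^ 2 * t ^ 2"
  by (simp_all add: syz_def)

text \<open>This identity has two uses: it turns combinations of columns 0 and 1 that are divisible
  by \<open>d\<close> into multiples of column 2, and it is the relation that generates the last
  module.\<close>

lemma syz_relation:
  "d * syz s d t 0 2 = (2 * (5 * s ^ 2 + t ^ 2)) * syz s d t 0 0 + (- 3 * s * t) * syz s d t 0 1"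
  "d * syz s d t 1 2 = (2 * (5 * s ^ 2 + t ^ 2)) * syz s d t 1 0 + (- 3 * s * t) * syz s d t 1 1"
  "d * syz s d t 2 2 = (2 * (5 * s ^ 2 + t ^ 2)) * syz s d t 2 0 + (- 3 * s * t) * syz s d t 2 1"
  unfolding syz_entries by (simp_all add: algebra_simps eval_nat_numeral)

lemma syz_is_syzygy:
  "arr_s s d t * syz s d t 0 0 + arr_d s d t * syz s d t 1 0 + arr_t s d t * syz s d t 2 0 = 0"
  "arr_s s d t * syz s d t 0 1 + arr_d s d t * syz s d t 1 1 + arr_t s d t * syz s d t 2 1 = 0"
  "arr_s s d t * syz s d t 0 2 + arr_d s d t * syz s d t 1 2 + arr_t s d t * syz s d t 2 2 = 0"
  unfolding syz_entries arr_partials by (simp_all add: algebra_simps eval_nat_numeral)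

text \<open>With a nonzero constant in place of \<open>d\<close> the first two columns would be a
  basis of the syzygies by Saito's criterion; the linear factor \<open>d\<close> is what makes a
  third generator necessary.\<close>

lemma syz_minors:
  "2 * (syz s d t 1 0 * syz s d t 2 1 - syz s d t 2 0 * syz s d t 1 1) = d * arr_s s d t"
  "2 * (syz s d t 2 0 * syz s d t 0 1 - syz s d t 0 0 * syz s d t 2 1) = d * arr_d s d t"
  "2 * (syz s d t 0 0 * syz s d t 1 1 - syz s d t 1 0 * syz s d t 0 1) = d * arr_t s d t"
  unfolding syz_entries arr_partials by (simp_all add: algebra_simps eval_nat_numeral)

text \<open>The curve is singular only on s = t = 0 and on the four lines, so some product of the
  corresponding linear forms lies in the jacobian ideal.\<close>

lemma binary_form_in_jacobian_ideal:
  "t * (4 * t ^ 2 - 11 * s ^ 2) * arr_s s d t + 5 * s * d * t * arr_d s d t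
     + s * (16 * s ^ 2 + t ^ 2) * arr_t s d t
   = - 32 * (s * t * (4 * s ^ 2 - t ^ 2) ^ 2 * (s ^ 2 + t ^ 2) ^ 2)"
  unfolding arr_partials by (simp add: algebra_simps eval_nat_numeral)

text \<open>The dual basis certifies that a, b, c are independent, supplies points with prescribed
  values of the three forms, and inverts the chain rule.\<close>

locale coordinates =
  fixes a b c a' b' c' :: "complex ^ 3"
  assumes dual: "pairing a a' = 1" "pairing a b' = 0" "pairing a c' = 0"
    "pairing b a' = 0" "pairing b b' = 1" "pairing b c' = 0"
    "pairing c a' = 0" "pairing c b' = 0" "pairing c c' = 1"
begin

definition S where "S = line_form a"
definition D where "D = line_form b"
definition T where "T = line_form c"

abbreviation "f \<equiv> arr S D T"
abbreviation "fS \<equiv> arr_s S D T"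
abbreviation "fD \<equiv> arr_d S D T"
abbreviation "fT \<equiv> arr_t S D T"

section \<open>The regular sequence, and vectors parallel to the gradient\<close>

lemma prime_elem_combination:
  assumes "x \<noteq> 0 \<or> y \<noteq> 0"
  shows "prime_elem (const x * S + const y * T)"
proof -
  have "\<exists>v. pairing (x *s a + y *s c) v = 1"
  proof (cases "x = 0")
    case False
    then show ?thesis by (intro exI[of _ "(1 / x) *s a'"]) (simp add: pairing_simps dual)
  next
    case True
    then show ?thesis using assms by (intro exI[of _ "(1 / y) *s c'"]) (simp add: pairing_simps dual)
  qed
  then show ?thesis
    using prime_elem_line_form[of "x *s a + y *s c"] by (auto simp: line_form_simps S_def T_def)
qed

definition at_point :: "complex \<Rightarrow> complex \<Rightarrow> complex \<Rightarrow> poly3 \<Rightarrow> complex" where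
  "at_point x y z = eval3 (\<lambda>c. c) (($h) (x *s a' + y *s b' + z *s c'))"

lemma at_point_coordinates: "at_point x y z S = x" "at_point x y z D = y" "at_point x y z T = z"
proof -
  have "eval3 (\<lambda>c. c) (($h) u) (line_form l) = pairing l u" for l u
    by (simp add: to_complex.eval3_line_form pairing_def)
  then show "at_point x y z S = x" "at_point x y z D = y" "at_point x y z T = z"
    by (simp_all add: at_point_def S_def D_def T_def pairing_simps dual)
qed

lemma at_point_simps:
  "at_point x y z (p + q) = at_point x y z p + at_point x y z q"
  "at_point x y z (p - q) = at_point x y z p - at_point x y z q"
  "at_point x y z (p * q) = at_point x y z p * at_point x y z q"
  "at_point x y z (p ^ n) = at_point x y z p ^ n"
  "at_point x y z (numeral k) = numeral k" "at_point x y z 0 = 0"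
  by (simp_all add: at_point_def to_complex.eval3_simps)

lemma at_point_arr:
  "at_point x y z fS = arr_s x y z" "at_point x y z fT = arr_t x y z"
  by (simp_all add: arr_partials at_point_simps at_point_coordinates)

lemma not_dvd:
  assumes "x * u + y * w = 0" and "at_point u v w p \<noteq> 0"
  shows "\<not> const x * S + const y * T dvd p"
  using not_line_form_dvd[of "x *s a + y *s c" "u *s a' + v *s b' + w *s c'" p] assms
  by (simp add: at_point_def line_form_simps S_def T_def pairing_simps dual mult.commute)

text \<open>The form is a product of powers of six linear forms in \<open>S\<close> and
  \<open>T\<close>, each prime. For each of them a point is chosen on its zero line at which
  \<open>fS + fT\<close> does not vanish.\<close>

lemma cancels_binary_form:
  "cancels (fS + fT) (S * T * (4 * S ^ 2 - T ^ 2) ^ 2 * (S ^ 2 + T ^ 2) ^ 2)"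
proof -
  have lin: "cancels (fS + fT) (const x * S + const y * T)"
    if "x \<noteq> 0 \<or> y \<noteq> 0" "x * u + y * w = 0" "arr_s u v w + arr_t u v w \<noteq> 0" for x y u v w
    using that
    by (intro cancels_prime prime_elem_combination not_dvd[of x u y w v]) (simp_all add: at_point_simps at_point_arr)
  have S: "cancels (fS + fT) S"
    using lin[of 1 0 0 1 1] by (simp add: arr_partials[where 'a = complex] const_simps)
  have T: "cancels (fS + fT) T"
    using lin[of 0 1 1 0 1] by (simp add: arr_partials[where 'a = complex] const_simps)
  have A: "cancels (fS + fT) (2 * S - T)"
    using lin[of 2 "- 1" 1 2 0] by (simp add: arr_partials[where 'a = complex] const_simps)
  have B: "cancels (fS + fT) (2 * S + T)"
    using lin[of 2 1 1 "- 2" 0] by (simp add: arr_partials[where 'a = complex] const_simps)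
  \<comment> \<open>Here \<open>d\<close> must not be 0: on \<open>s ^ 2 + t ^ 2 = 0\<close> the
    quartic factor equals \<open>5 * d ^ 4\<close>, so \<open>d = 0\<close> is the point of contact
    of the hyperosculating line, where the whole gradient vanishes.\<close>
  have C: "cancels (fS + fT) (S + const \<i> * T)"
    using lin[of 1 \<i> "- \<i>" 1 1]
    by (simp add: arr_partials[where 'a = complex] const_simps eval_nat_numeral algebra_simps complex_eq_iff)
  have E: "cancels (fS + fT) (S - const \<i> * T)"
    using lin[of 1 "- \<i>" \<i> 1 1]
    by (simp add: arr_partials[where 'a = complex] const_simps eval_nat_numeral algebra_simps complex_eq_iff)
  have i2: "const \<i> * const \<i> = - 1"
    by (metis const_simps(2,4,5) i_squared)
  have "S * T * ((2 * S - T) * (2 * S + T)) ^ 2 * ((S + const \<i> * T) * (S - const \<i> * T)) ^ 2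
      = S * T * (4 * S ^ 2 - T ^ 2) ^ 2 * (S ^ 2 - const \<i> * const \<i> * T ^ 2) ^ 2"
    by (simp add: algebra_simps eval_nat_numeral)
  also have "\<dots> = S * T * (4 * S ^ 2 - T ^ 2) ^ 2 * (S ^ 2 + T ^ 2) ^ 2"
    by (simp add: i2)
  finally show ?thesis
    using S T A B C E by (metis cancels_mult power2_eq_square)
qed

text \<open>\<open>W\<close> is the combination that expresses \<open>- 32 * E\<close> through the
  gradient, with w in place of the gradient. Parallelism gives \<open>W * fS = - 32 * E * w1\<close>
  and \<open>W * fT = - 32 * E * w3\<close>; adding them shows that \<open>E\<close> divides
  \<open>W * (fS + fT)\<close>, hence \<open>W\<close>, and the quotient is k up to the factor
  -1/32.\<close>

lemma parallel_to_gradient: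
  assumes "w1 * fD = w2 * fS" and "w1 * fT = w3 * fS"
  obtains k where "w1 = k * fS" "w2 = k * fD" "w3 = k * fT"
proof -
  define E where "E = S * T * (4 * S ^ 2 - T ^ 2) ^ 2 * (S ^ 2 + T ^ 2) ^ 2"
  define W where "W = T * (4 * T ^ 2 - 11 * S ^ 2) * w1 + 5 * S * D * T * w2 + S * (16 * S ^ 2 + T ^ 2) * w3"
  have fS: "fS \<noteq> 0"
  proof
    assume "fS = 0"
    then have "arr_s 1 0 0 = (0 :: complex)" using at_point_arr(1)[of 1 0 0] by (simp add: at_point_simps)
    then show False by (simp add: arr_s_def)
  qed
  have "W * fS = (T * (4 * T ^ 2 - 11 * S ^ 2) * fS + 5 * S * D * T * fD + S * (16 * S ^ 2 + T ^ 2) * fT) * w1"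
  proof -
    have "W * fS = T * (4 * T ^ 2 - 11 * S ^ 2) * (w1 * fS) + 5 * S * D * T * (w2 * fS)
        + S * (16 * S ^ 2 + T ^ 2) * (w3 * fS)"
      by (simp add: W_def distrib_left distrib_right mult_ac)
    then show ?thesis unfolding assms[symmetric] by (simp add: distrib_left distrib_right mult_ac)
  qed
  then have WS: "W * fS = - 32 * E * w1" unfolding binary_form_in_jacobian_ideal E_def by simp
  have WT: "W * fT = - 32 * E * w3"
  proof -
    have "fS * (W * fT) = fT * (W * fS)" by (simp add: mult_ac)
    also have "\<dots> = - 32 * E * (w1 * fT)" by (simp add: WS mult_ac)
    also have "\<dots> = fS * (- 32 * E * w3)" unfolding assms(2) by (simp add: mult_ac)
    finally show ?thesis using fS by (simp only: mult_cancel_left) simp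
  qed
  have "W * (fS + fT) = E * (- 32 * (w1 + w3))"
    unfolding distrib_left[of W] WS WT by (simp add: algebra_simps)
  then have "E dvd W * (fS + fT)" by simp
  note E = cancels_binary_form[folded E_def]
  have "E dvd W" by (rule cancelsD(2)[OF E \<open>E dvd W * (fS + fT)\<close>])
  then obtain k where k: "W = E * k" by (elim dvdE)
  have "E * (k * fS + 32 * w1) = 0" using WS by (simp add: k algebra_simps)
  then have "32 * w1 = - k * fS" using cancelsD(1)[OF E] by (simp add: add_eq_0_iff)
  moreover have "const (1 / 32) * 32 = 1"
    using const_simps(4)[of "1 / 32" 32] by (simp add: const_simps)
  ultimately have w1: "w1 = (- const (1 / 32) * k) * fS"
    by (metis (no_types, lifting) mult.assoc mult.left_neutral mult_minus_left mult_minus_right)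
  have "fS * w2 = fS * ((- const (1 / 32) * k) * fD)" "fS * w3 = fS * ((- const (1 / 32) * k) * fT)"
    using assms unfolding w1 by (simp_all add: mult_ac)
  then have "w2 = (- const (1 / 32) * k) * fD" "w3 = (- const (1 / 32) * k) * fT"
    using fS by (simp_all only: mult_cancel_left) auto
  with w1 show ?thesis by (rule that)
qed

lemma partial_deriv_arr:
  "partial_deriv i f = const (a $h i) * fS + const (b $h i) * fD + const (c $h i) * fT"
proof -
  have [simp]: "partial_deriv i S = const (a $h i)" "partial_deriv i D = const (b $h i)"
    "partial_deriv i T = const (c $h i)"
    by (simp_all add: S_def D_def T_def partial_deriv_line_form)
  show ?thesis
    unfolding arr_def arr_partials
    by (simp add: eval_nat_numeral partial_deriv_add partial_deriv_diff partial_deriv_mult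
        partial_deriv_1 partial_deriv_numeral algebra_simps)
qed

lemma gradient_eq_dual_combination:
  "fS = (\<Sum>i\<in>UNIV. const (a' $h i) * partial_deriv i f)"
  "fD = (\<Sum>i\<in>UNIV. const (b' $h i) * partial_deriv i f)"
  "fT = (\<Sum>i\<in>UNIV. const (c' $h i) * partial_deriv i f)"
proof -
  have "(\<Sum>i\<in>UNIV. const (v $h i) * partial_deriv i f)
      = const (pairing a v) * fS + const (pairing b v) * fD + const (pairing c v) * fT" for v
    by (simp add: partial_deriv_arr pairing_def sum_3 const_simps algebra_simps)
  then show "fS = (\<Sum>i\<in>UNIV. const (a' $h i) * partial_deriv i f)"
    "fD = (\<Sum>i\<in>UNIV. const (b' $h i) * partial_deriv i f)"
    "fT = (\<Sum>i\<in>UNIV. const (c' $h i) * partial_deriv i f)"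
    by (simp_all add: dual const_simps)
qed

end

section \<open>Degrees, reducedness and the graded resolution\<close>

lemma homogeneous_add_intro:
  "homogeneous k p \<Longrightarrow> homogeneous l q \<Longrightarrow> k = l \<Longrightarrow> homogeneous k (p + q)"
  by (simp add: homogeneous_add)

lemma homogeneous_diff_intro:
  "homogeneous k p \<Longrightarrow> homogeneous l q \<Longrightarrow> k = l \<Longrightarrow> homogeneous k (p - q)"
  by (simp add: homogeneous_diff)

text \<open>Leaves the degree schematic while the introduction rules compute it, and compares it
  with the expected value afterwards.\<close>

lemma homogeneous_cong: "homogeneous k p \<Longrightarrow> k = l \<Longrightarrow> homogeneous l p"
  by simp

context coordinates
begin

abbreviation "P \<equiv> 2 * (5 * S ^ 2 + T ^ 2)"
abbreviation "Q \<equiv> - 3 * S * T"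
abbreviation "syzygy \<equiv> syz S D T"

lemma nonzero_at_point: "at_point x y z p \<noteq> 0 \<Longrightarrow> p \<noteq> 0"
  by (auto simp: at_point_simps)

lemma arr_s_nonzero: "fS \<noteq> 0"
  by (rule nonzero_at_point[of 1 0 0]) (simp add: at_point_arr, simp add: arr_s_def)

lemma arr_t_nonzero: "fT \<noteq> 0"
  by (rule nonzero_at_point[of 0 1 1]) (simp add: at_point_arr, simp add: arr_t_def)

lemma D_nonzero: "D \<noteq> 0"
  by (rule nonzero_at_point[of 0 1 0]) (simp add: at_point_coordinates)

lemma prime_elem_coordinates: "prime_elem S" "prime_elem D" "prime_elem T"
  unfolding S_def D_def T_def by (rule prime_elem_line_form, rule dual)+

text \<open>\<open>S\<close> and \<open>T\<close> are the prime factors of \<open>Q\<close> up to a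
  unit, so this makes \<open>P\<close> and \<open>Q\<close> coprime; \<open>D\<close> serves the
  relations among the generators.\<close>

lemma coordinates_not_dvd_P: "\<not> S dvd P" "\<not> D dvd P" "\<not> T dvd P"
proof -
  have *: "at_point x y z P = 2 * (5 * x ^ 2 + z ^ 2)" for x y z
    by (simp add: at_point_simps at_point_coordinates)
  have "at_point x y z p = 0" if "l dvd p" "at_point x y z l = 0" for l p x y z
    using that by (auto elim!: dvdE simp: at_point_simps)
  from this[of S P 0 0 1] this[of D P 1 0 0] this[of T P 1 0 0]
  show "\<not> S dvd P" "\<not> D dvd P" "\<not> T dvd P" unfolding * by (auto simp: at_point_coordinates)
qed

text \<open>If the square of g divides \<open>f\<close>, then g divides the gradient. The quotient
  vector is parallel to the gradient, hence k times it, so \<open>g * k = 1\<close>.\<close>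

lemma squarefree_arr: "squarefree f"
  unfolding squarefree_def
proof (intro allI impI)
  fix g assume "g\<^sup>2 dvd f"
  then obtain h where h: "f = g * (g * h)" by (metis dvdE power2_eq_square mult.assoc)
  have "g dvd partial_deriv i f" for i
    unfolding h by (simp add: partial_deriv_mult)
  then have "g dvd fS" "g dvd fD" "g dvd fT"
    unfolding gradient_eq_dual_combination by (auto intro!: dvd_sum)
  then obtain w1 w2 w3 where w: "fS = g * w1" "fD = g * w2" "fT = g * w3" by (elim dvdE)
  have "w1 * fD = w2 * fS" "w1 * fT = w3 * fS" unfolding w by (simp_all add: mult_ac)
  then obtain k where k: "w1 = k * fS" by (rule parallel_to_gradient)
  have "fS * 1 = fS * (g * k)" using w(1) by (metis k mult.assoc mult.commute mult_1_right)
  then have "1 = g * k" using arr_s_nonzero by (simp only: mult_cancel_left) simp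
  then show "g dvd 1" by (rule dvdI)
qed

lemma homogeneous_coordinates: "homogeneous 1 S" "homogeneous 1 D" "homogeneous 1 T"
  unfolding S_def D_def T_def by (rule homogeneous_line_form)+

lemmas homogeneous_intros = homogeneous_add_intro homogeneous_diff_intro homogeneous_uminus
  homogeneous_mult homogeneous_power homogeneous_numeral homogeneous_coordinates

lemma homogeneous_arr: "homogeneous 8 f"
  unfolding arr_def by (rule homogeneous_cong, (rule homogeneous_intros | simp)+)

lemma homogeneous_arr_partials: "homogeneous 7 fS" "homogeneous 7 fD" "homogeneous 7 fT"
  unfolding arr_partials by (rule homogeneous_cong, (rule homogeneous_intros | simp)+)+

lemma homogeneous_syz:
  assumes "i < 3"
  shows "homogeneous 4 (syzygy i 0)" "homogeneous 4 (syzygy i 1)" "homogeneous 5 (syzygy i 2)"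
proof -
  have "homogeneous 4 (syzygy 0 0)" "homogeneous 4 (syzygy 0 1)" "homogeneous 5 (syzygy 0 2)"
    "homogeneous 4 (syzygy 1 0)" "homogeneous 4 (syzygy 1 1)" "homogeneous 5 (syzygy 1 2)"
    "homogeneous 4 (syzygy 2 0)" "homogeneous 4 (syzygy 2 1)" "homogeneous 5 (syzygy 2 2)"
    unfolding syz_entries by (rule homogeneous_cong, (rule homogeneous_intros | simp)+)+
  moreover have "i = 0 \<or> i = 1 \<or> i = 2" using assms by linarith
  ultimately show "homogeneous 4 (syzygy i 0)" "homogeneous 4 (syzygy i 1)" "homogeneous 5 (syzygy i 2)"
    by blast+
qed

lemma homogeneous_PQD: "homogeneous 2 P" "homogeneous 2 Q" "homogeneous 1 (- D)"
  by (rule homogeneous_cong, (rule homogeneous_intros | simp)+)+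

lemma syzygies_generated:
  assumes u: "fS * u1 + fD * u2 + fT * u3 = 0"
  shows "\<exists>x y z. u1 = syzygy 0 0 * x + syzygy 0 1 * y + syzygy 0 2 * z
    \<and> u2 = syzygy 1 0 * x + syzygy 1 1 * y + syzygy 1 2 * z
    \<and> u3 = syzygy 2 0 * x + syzygy 2 1 * y + syzygy 2 2 * z"
proof -
  obtain c where c: "u2 * syzygy 2 0 - u3 * syzygy 1 0 = c * fS"
      "u3 * syzygy 0 0 - u1 * syzygy 2 0 = c * fD" "u1 * syzygy 1 0 - u2 * syzygy 0 0 = c * fT"
    by (rule parallel_to_gradient[OF cross_product_of_syzygies_parallel[OF u syz_is_syzygy(1)]])
  obtain e where e: "u2 * syzygy 2 1 - u3 * syzygy 1 1 = e * fS"
      "u3 * syzygy 0 1 - u1 * syzygy 2 1 = e * fD" "u1 * syzygy 1 1 - u2 * syzygy 0 1 = e * fT"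
    by (rule parallel_to_gradient[OF cross_product_of_syzygies_parallel[OF u syz_is_syzygy(2)]])
  define A B where "A = 2 * e" and "B = - 2 * c"
  have Du: "D * u1 = A * syzygy 0 0 + B * syzygy 0 1" "D * u2 = A * syzygy 1 0 + B * syzygy 1 1"
    "D * u3 = A * syzygy 2 0 + B * syzygy 2 1"
    using multiple_of_syzygy_combination[OF c e syz_minors D_nonzero arr_t_nonzero]
    by (simp_all add: A_def B_def)
  define \<pi> where "\<pi> = project_along b b'"
  have \<pi>_hom: "\<pi> (p + q) = \<pi> p + \<pi> q" "\<pi> (p - q) = \<pi> p - \<pi> q" "\<pi> (- p) = - \<pi> p"
    "\<pi> (p * q) = \<pi> p * \<pi> q" "\<pi> (p ^ n) = \<pi> p ^ n" "\<pi> (numeral k) = numeral k" for p q n k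
    by (simp_all add: \<pi>_def project_along_simps)
  have \<pi>: "\<pi> S = S" "\<pi> D = 0" "\<pi> T = T"
    by (simp_all add: \<pi>_def S_def D_def T_def project_along_line_form dual const_simps)
  \<comment> \<open>Modulo \<open>D\<close> rows 0 and 2 of columns 0 and 1 vanish, so row 1 carries
    all the information: its entries become \<open>(S ^ 2 + T ^ 2) * Q\<close> and
    \<open>- (S ^ 2 + T ^ 2) * P\<close>.\<close>
  have "0 = \<pi> A * \<pi> (syzygy 1 0) + \<pi> B * \<pi> (syzygy 1 1)"
    using arg_cong[OF Du(2), of \<pi>] by (simp add: \<pi>_hom \<pi>)
  also have "\<dots> = (S ^ 2 + T ^ 2) * (Q * \<pi> A - P * \<pi> B)"
    unfolding syz_entries \<pi>_hom \<pi> by (simp add: algebra_simps eval_nat_numeral)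
  finally have "(S ^ 2 + T ^ 2) * (Q * \<pi> A - P * \<pi> B) = 0" by simp
  moreover have "S ^ 2 + T ^ 2 \<noteq> 0"
    by (rule nonzero_at_point[of 1 0 0]) (simp add: at_point_simps at_point_coordinates)
  ultimately have "Q * \<pi> A - P * \<pi> B = 0" by (simp only: mult_eq_0_iff) simp
  then have QA: "S * (- 3 * T * \<pi> A) = P * \<pi> B" by (simp add: algebra_simps)
  \<comment> \<open>Coprimality of \<open>P\<close> and \<open>Q\<close> is applied one linear
    factor of \<open>Q\<close> at a time; the remaining factor -3 is a unit.\<close>
  then have "S dvd P * \<pi> B" by (metis dvd_triv_left)
  then have "S dvd \<pi> B"
    using prime_elem_dvd_multD[OF prime_elem_coordinates(1)] coordinates_not_dvd_P(1) by blast
  then obtain B1 where B1: "\<pi> B = S * B1" by (elim dvdE)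
  have "S * (T * (- 3 * \<pi> A)) = S * (P * B1)" using QA by (simp add: B1 algebra_simps)
  then have TA: "T * (- 3 * \<pi> A) = P * B1"
    using prime_elem_not_zeroI[OF prime_elem_coordinates(1)] by (simp only: mult_cancel_left) simp
  then have "T dvd P * B1" by (metis dvd_triv_left)
  then have "T dvd B1"
    using prime_elem_dvd_multD[OF prime_elem_coordinates(3)] coordinates_not_dvd_P(3) by blast
  then obtain B2 where B2: "B1 = T * B2" by (elim dvdE)
  have "T * (- 3 * \<pi> A) = T * (P * B2)" using TA by (simp add: B2 algebra_simps)
  then have A2: "- 3 * \<pi> A = P * B2"
    using prime_elem_not_zeroI[OF prime_elem_coordinates(3)] by (simp only: mult_cancel_left) simp
  define g where "g = - const (1 / 3) * B2"
  have third: "const (1 / 3) * (3 * p) = p" for p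
    using const_simps(4)[of "1 / 3" 3] by (simp add: const_simps mult.assoc[symmetric])
  have gA: "\<pi> A = P * g"
  proof -
    have "P * g = - const (1 / 3) * (P * B2)" by (simp add: g_def mult_ac)
    also have "\<dots> = const (1 / 3) * (3 * \<pi> A)" unfolding A2[symmetric] by simp
    finally show ?thesis by (simp add: third)
  qed
  have gB: "\<pi> B = Q * g"
  proof -
    have "Q * g = const (1 / 3) * (3 * (S * T * B2))" by (simp add: g_def mult_ac)
    then show ?thesis by (simp only: third B1 B2 mult.assoc)
  qed
  obtain a1 where a1: "A - \<pi> A = D * a1"
    using line_form_dvd_diff_project_along[of b A b'] by (auto simp: D_def \<pi>_def elim: dvdE)
  obtain b1 where b1: "B - \<pi> B = D * b1"
    using line_form_dvd_diff_project_along[of b B b'] by (auto simp: D_def \<pi>_def elim: dvdE)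
  \<comment> \<open>Modulo \<open>D\<close> the coefficients are the multiple \<open>g\<close> of
    \<open>(P, Q)\<close>, and that combination of columns 0 and 1 is \<open>D\<close> times column
    2. Hence \<open>D\<close> can be cancelled throughout.\<close>
  have AB: "A = P * g + D * a1" "B = Q * g + D * b1"
    using a1 b1 gA gB by (simp_all add: algebra_simps)
  have "D * u = D * (syzygy i 0 * a1 + syzygy i 1 * b1 + syzygy i 2 * g)"
    if "D * u = A * syzygy i 0 + B * syzygy i 1" "D * syzygy i 2 = P * syzygy i 0 + Q * syzygy i 1"
    for u i
  proof -
    have "D * u = D * (syzygy i 0 * a1 + syzygy i 1 * b1) + (P * syzygy i 0 + Q * syzygy i 1) * g"
      unfolding that(1) AB by (simp add: algebra_simps)
    then show ?thesis unfolding that(2)[symmetric] by (simp add: algebra_simps)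
  qed
  note this[OF Du(1) syz_relation(1)] this[OF Du(2) syz_relation(2)] this[OF Du(3) syz_relation(3)]
  then have "u1 = syzygy 0 0 * a1 + syzygy 0 1 * b1 + syzygy 0 2 * g"
    "u2 = syzygy 1 0 * a1 + syzygy 1 1 * b1 + syzygy 1 2 * g"
    "u3 = syzygy 2 0 * a1 + syzygy 2 1 * b1 + syzygy 2 2 * g"
    using D_nonzero by (simp_all only: mult_cancel_left) simp_all
  then show ?thesis by blast
qed

text \<open>Multiplying a relation by \<open>D\<close> and eliminating column 2 gives a relation
  between columns 0 and 1 with coefficients \<open>X\<close> and \<open>Y\<close>. Their minor in
  the first two rows is nonzero, so \<open>X = Y = 0\<close>, and then \<open>D\<close> divides
  \<open>P * z\<close>, hence z.\<close>

lemma relations_generated: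
  assumes rel: "syzygy 0 0 * x + syzygy 0 1 * y + syzygy 0 2 * z = 0"
    "syzygy 1 0 * x + syzygy 1 1 * y + syzygy 1 2 * z = 0"
  shows "\<exists>k. x = P * k \<and> y = Q * k \<and> z = - D * k"
proof -
  define X Y where "X = D * x + P * z" and "Y = D * y + Q * z"
  have XY: "syzygy i 0 * X + syzygy i 1 * Y = 0"
    if "syzygy i 0 * x + syzygy i 1 * y + syzygy i 2 * z = 0"
      "D * syzygy i 2 = P * syzygy i 0 + Q * syzygy i 1" for i
  proof -
    have "syzygy i 0 * X + syzygy i 1 * Y
        = D * (syzygy i 0 * x + syzygy i 1 * y) + (P * syzygy i 0 + Q * syzygy i 1) * z"
      by (simp add: X_def Y_def algebra_simps)
    also have "\<dots> = D * (syzygy i 0 * x + syzygy i 1 * y + syzygy i 2 * z)"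
      unfolding that(2)[symmetric] by (simp add: algebra_simps)
    finally show ?thesis by (simp only: that(1) mult_zero_right)
  qed
  note XY = XY[OF rel(1) syz_relation(1)] XY[OF rel(2) syz_relation(2)]
  define n where "n = syzygy 0 0 * syzygy 1 1 - syzygy 1 0 * syzygy 0 1"
  have "n \<noteq> 0"
    using syz_minors(3)[of S D T] D_nonzero arr_t_nonzero by (auto simp: n_def)
  have "n * X = syzygy 1 1 * (syzygy 0 0 * X + syzygy 0 1 * Y)
      - syzygy 0 1 * (syzygy 1 0 * X + syzygy 1 1 * Y)"
    "n * Y = syzygy 0 0 * (syzygy 1 0 * X + syzygy 1 1 * Y)
      - syzygy 1 0 * (syzygy 0 0 * X + syzygy 0 1 * Y)"
    by (simp_all add: n_def algebra_simps)
  then have "n * X = 0" "n * Y = 0" unfolding XY by simp_all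
  then have "X = 0" "Y = 0" using \<open>n \<noteq> 0\<close> by simp_all
  then have x: "D * x = - (P * z)" and y: "D * y = - (Q * z)"
    by (simp_all only: X_def Y_def eq_neg_iff_add_eq_0)
  have "D dvd P * z" using x by (metis dvd_minus_iff dvd_triv_left)
  then have "D dvd z"
    using prime_elem_dvd_multD[OF prime_elem_coordinates(2)] coordinates_not_dvd_P(2) by blast
  then obtain k where k: "z = D * k" by (elim dvdE)
  have "D * x = D * (P * - k)" "D * y = D * (Q * - k)"
    using x y by (simp_all add: k algebra_simps)
  then have "x = P * - k" "y = Q * - k" using D_nonzero by (simp_all only: mult_cancel_left) simp_all
  then show ?thesis using k by (intro exI[of _ "- k"]) simp
qed

lemma jacobian_ideal_arr:
  "jacobian_ideal f = {(\<Sum>j<3. [fS, fD, fT] ! j * g j) | g. True}"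
proof (intro equalityI subsetI)
  fix w assume "w \<in> jacobian_ideal f"
  then obtain g where g: "w = (\<Sum>i\<in>UNIV. g i * partial_deriv i f)" by (auto simp: jacobian_ideal_def)
  define h where "h j = (\<Sum>i\<in>UNIV. g i * const ([a, b, c] ! j $h i))" for j
  have "w = (\<Sum>j<3. [fS, fD, fT] ! j * h j)"
    by (simp add: g h_def sum_3 partial_deriv_arr numeral_3_eq_3 algebra_simps)
  then show "w \<in> {(\<Sum>j<3. [fS, fD, fT] ! j * g j) | g. True}" by blast
next
  fix w assume "w \<in> {(\<Sum>j<3. [fS, fD, fT] ! j * g j) | g. True}"
  then obtain g where "w = (\<Sum>j<3. [fS, fD, fT] ! j * g j)" by blast
  then have g: "w = fS * g 0 + fD * g 1 + fT * g 2" by (simp add: numeral_3_eq_3 numeral_2_eq_2)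
  define h where "h i = const (a' $h i) * g 0 + const (b' $h i) * g 1 + const (c' $h i) * g 2" for i
  have "w = (\<Sum>i\<in>UNIV. h i * partial_deriv i f)"
    unfolding g gradient_eq_dual_combination by (simp add: h_def sum_3 algebra_simps)
  then show "w \<in> jacobian_ideal f" by (auto simp: jacobian_ideal_def)
qed

text \<open>The shifts are 7 = 8 - 1 for the partials, 7 + 4, 7 + 4, 7 + 5 for the syzygies, and 13
  = 11 + 2 = 12 + 1 for the relation with entries \<open>P\<close>, \<open>Q\<close>,
  \<open>- D\<close>. The index 2 points at the nonzero entry \<open>- D\<close>.\<close>

lemma resolution_arr:
  "has_minimal_graded_free_resolution (jacobian_ideal f) [7, 7, 7] [11, 11, 12] [13]"
proof (rule has_minimal_graded_free_resolutionI[where n = 3 and m = 3 and F = "(!) [fS, fD, fT]"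
      and M = syzygy and K = "(!) [P, Q, - D]" and ?j0.0 = 2])
  have sum3: "(\<Sum>j<3. h j) = h 0 + h 1 + h 2" for h :: "nat \<Rightarrow> poly3"
    by (simp add: numeral_3_eq_3 numeral_2_eq_2)
  have less3: "j < 3 \<longleftrightarrow> j = 0 \<or> j = 1 \<or> j = 2" for j :: nat by linarith
  show "homogeneous ([7, 7, 7] ! j) ([fS, fD, fT] ! j) \<and> [7, 7, 7] ! j \<noteq> (0 :: int)" if "j < 3" for j
    using that homogeneous_arr_partials by (auto simp: less3)
  show "homogeneous ([11, 11, 12] ! j - [7, 7, 7] ! i) (syzygy i j) \<and> [11, 11, 12] ! j \<noteq> ([7, 7, 7] ! i :: int)"
    if "i < 3" "j < 3" for i j
    using homogeneous_syz[OF that(1)] that by (auto simp: less3)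
  show "homogeneous ([13] ! 0 - [11, 11, 12] ! j) ([P, Q, - D] ! j) \<and> [13] ! 0 \<noteq> ([11, 11, 12] ! j :: int)"
    if "j < 3" for j
    using homogeneous_PQD that by (auto simp: less3)
  show "jacobian_ideal f = {(\<Sum>j<3. [fS, fD, fT] ! j * g j) | g. True}"
    by (rule jacobian_ideal_arr)
  show "(\<Sum>i<3. [fS, fD, fT] ! i * syzygy i j) = 0" if "j < 3" for j
    using that syz_is_syzygy[of S D T] by (auto simp: sum3 less3)
  show "\<exists>x. \<forall>i<3. u i = (\<Sum>j<3. syzygy i j * x j)" if "(\<Sum>i<3. [fS, fD, fT] ! i * u i) = 0" for u
  proof -
    have "fS * u 0 + fD * u 1 + fT * u 2 = 0" using that by (simp add: sum3)
    from syzygies_generated[OF this] obtain x y z where xyz: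
      "u 0 = syzygy 0 0 * x + syzygy 0 1 * y + syzygy 0 2 * z"
      "u 1 = syzygy 1 0 * x + syzygy 1 1 * y + syzygy 1 2 * z"
      "u 2 = syzygy 2 0 * x + syzygy 2 1 * y + syzygy 2 2 * z" by blast
    then show ?thesis by (intro exI[of _ "(!) [x, y, z]"]) (auto simp: sum3 less3)
  qed
  show "(\<Sum>j<3. syzygy i j * [P, Q, - D] ! j) = 0" if "i < 3" for i
    using that syz_relation[of D S T] by (auto simp: sum3 less3 mult.commute)
  show "\<exists>k. \<forall>j<3. x j = [P, Q, - D] ! j * k" if rel: "\<And>i. i < 3 \<Longrightarrow> (\<Sum>j<3. syzygy i j * x j) = 0" for x
  proof -
    have "\<exists>k. x 0 = P * k \<and> x 1 = Q * k \<and> x 2 = - D * k"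
      using rel[of 0] rel[of 1] by (intro relations_generated) (simp_all add: sum3)
    then show ?thesis by (auto simp: less3)
  qed
  show "[P, Q, - D] ! 2 \<noteq> 0" using D_nonzero by simp
qed simp_all

theorem plus_one_generated_arr: "plus_one_generated f"
  unfolding plus_one_generated_def
proof (intro exI conjI)
  show "syzygy_curve 3 8 [4, 4, 5] f"
    unfolding syzygy_curve_def reduced_curve_def
  proof (intro conjI exI[of _ "[13]"])
    show "has_minimal_graded_free_resolution (jacobian_ideal f) (replicate 3 (int 8 - 1))
        (map (\<lambda>k. int 8 - 1 + int k) [4, 4, 5]) [13]"
      using resolution_arr by (simp add: numeral_3_eq_3)
  qed (use homogeneous_arr squarefree_arr in simp_all)
qed simp_all

end

section \<open>Bitangents of the Komiya--Kuribayashi quartic\<close>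

text \<open>The values of the quartic, written with power sums to make the symmetry visible.\<close>

definition kk :: "complex ^ 3 \<Rightarrow> complex" where
  "kk P = (3 * (\<Sum>i\<in>UNIV. (P $h i) ^ 2) ^ 2 - (\<Sum>i\<in>UNIV. (P $h i) ^ 4)) / 2"

text \<open>The order at 0 sees only the contact at the first point. Exchanging the points reverses
  the coefficients, so contact at both ends can be read from one list.\<close>

lemma restrict_line_komiya_kuribayashi:
  obtains g0 g1 g2 g3 g4 where
    "restrict_line komiya_kuribayashi P Q = [:g0, g1, g2, g3, g4:]"
    "restrict_line komiya_kuribayashi Q P = [:g4, g3, g2, g1, g0:]"
    "\<And>u v. kk (u *s P + v *s Q) = g0 * u ^ 4 + g1 * u ^ 3 * v + g2 * u ^ 2 * v ^ 2 + g3 * u * v ^ 3 + g4 * v ^ 4"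
proof -
  define e0 where "e0 P = P 1 ^ 4 + P 2 ^ 4 + P 3 ^ 4
    + 3 * (P 1 ^ 2 * P 2 ^ 2 + P 1 ^ 2 * P 3 ^ 2 + P 2 ^ 2 * P 3 ^ 2)" for P :: "3 \<Rightarrow> complex"
  define e1 where "e1 P Q = 4 * (P 1 ^ 3 * Q 1 + P 2 ^ 3 * Q 2 + P 3 ^ 3 * Q 3)
    + 6 * (P 1 * Q 1 * (P 2 ^ 2 + P 3 ^ 2) + P 2 * Q 2 * (P 1 ^ 2 + P 3 ^ 2) + P 3 * Q 3 * (P 1 ^ 2 + P 2 ^ 2))"
    for P Q :: "3 \<Rightarrow> complex"
  define e2 where "e2 P Q = 6 * (P 1 ^ 2 * Q 1 ^ 2 + P 2 ^ 2 * Q 2 ^ 2 + P 3 ^ 2 * Q 3 ^ 2)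
    + 3 * (P 1 ^ 2 * Q 2 ^ 2 + Q 1 ^ 2 * P 2 ^ 2 + 4 * P 1 * Q 1 * P 2 * Q 2
         + P 1 ^ 2 * Q 3 ^ 2 + Q 1 ^ 2 * P 3 ^ 2 + 4 * P 1 * Q 1 * P 3 * Q 3
         + P 2 ^ 2 * Q 3 ^ 2 + Q 2 ^ 2 * P 3 ^ 2 + 4 * P 2 * Q 2 * P 3 * Q 3)"
    for P Q :: "3 \<Rightarrow> complex"
  note e = e0_def e1_def e2_def
  have three: "(3 :: complex poly) = [:3:]" by (simp add: numeral_poly)
  have r: "restrict_line komiya_kuribayashi P Q
      = [:e0 (($h) P), e1 (($h) P) (($h) Q), e2 (($h) P) (($h) Q), e1 (($h) Q) (($h) P), e0 (($h) Q):]"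
    for P Q
    unfolding restrict_line_eq_eval3 komiya_kuribayashi_def Let_def to_poly.eval3_simps three e
    by (simp add: eval_nat_numeral algebra_simps)
  have "e2 (($h) Q) (($h) P) = e2 (($h) P) (($h) Q)" by (simp add: e algebra_simps)
  moreover have "kk (u *s P + v *s Q) = e0 (($h) P) * u ^ 4 + e1 (($h) P) (($h) Q) * u ^ 3 * v
      + e2 (($h) P) (($h) Q) * u ^ 2 * v ^ 2 + e1 (($h) Q) (($h) P) * u * v ^ 3 + e0 (($h) Q) * v ^ 4"
    for u v
    unfolding kk_def e by (simp add: sum_3 eval_nat_numeral field_simps)
  ultimately show ?thesis using that r[of P Q] r[of Q P] by simp
qed

section \<open>The quartic restricted to a bitangent is a square\<close>

lemma proj_eq_sym: "proj_eq P Q \<Longrightarrow> proj_eq Q P"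
  unfolding proj_eq_def
proof (elim exE conjE)
  fix c assume "c \<noteq> 0" "Q = c *s P"
  then show "\<exists>d. d \<noteq> 0 \<and> P = d *s Q"
    by (intro exI[of _ "1 / c"]) (simp add: vector_smult_assoc)
qed

lemma proj_eq_refl: "proj_eq P P"
  unfolding proj_eq_def by (intro exI[of _ 1]) simp

text \<open>U, V, W are the cross products of l with the unit vectors, up to sign. Where l has a
  nonzero entry, two of them are nonzero and not proportional, so P is proportional to at most one
  of these.\<close>

lemma exists_second_point:
  assumes "l \<noteq> 0"
  obtains Q where "Q \<noteq> 0" "on_line l Q" "\<not> proj_eq P Q"
proof -
  define U V W where "U = (vector [0, l $h 3, - (l $h 2)] :: complex ^ 3)"
    and "V = (vector [- (l $h 3), 0, l $h 1] :: complex ^ 3)"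
    and "W = (vector [l $h 2, - (l $h 1), 0] :: complex ^ 3)"
  note UVW = U_def V_def W_def
  have on: "on_line l U" "on_line l V" "on_line l W"
    by (simp_all add: UVW on_line_def sum_3 vector_3)
  have eqs: "U \<noteq> 0 \<longleftrightarrow> l $h 3 \<noteq> 0 \<or> l $h 2 \<noteq> 0" "V \<noteq> 0 \<longleftrightarrow> l $h 3 \<noteq> 0 \<or> l $h 1 \<noteq> 0"
    "W \<noteq> 0 \<longleftrightarrow> l $h 2 \<noteq> 0 \<or> l $h 1 \<noteq> 0"
    by (auto simp: UVW Finite_Cartesian_Product.vec_eq_iff forall_3 vector_3)
  have trans: "\<exists>c. c \<noteq> 0 \<and> R' = c *s R" if "proj_eq P R" "proj_eq P R'" for R R'
  proof -
    from proj_eq_sym[OF that(1)] that(2) obtain c d where "c \<noteq> 0" "d \<noteq> 0" "P = c *s R" "R' = d *s P"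
      unfolding proj_eq_def by blast
    then show ?thesis by (intro exI[of _ "d * c"]) (simp add: vector_smult_assoc)
  qed
  have "l $h 1 \<noteq> 0 \<or> l $h 2 \<noteq> 0 \<or> l $h 3 \<noteq> 0" using assms by (auto simp: Finite_Cartesian_Product.vec_eq_iff forall_3)
  then consider "l $h 1 \<noteq> 0" | "l $h 2 \<noteq> 0" | "l $h 3 \<noteq> 0" by blast
  then show ?thesis
  proof cases
    case 1
    then have "V \<noteq> 0" "W \<noteq> 0" by (simp_all add: eqs)
    moreover have "\<not> (proj_eq P V \<and> proj_eq P W)"
      using trans[of V W] 1 by (auto simp: UVW Finite_Cartesian_Product.vec_eq_iff forall_3 vector_3)
    ultimately show ?thesis using that on by blast
  next
    case 2
    then have "U \<noteq> 0" "W \<noteq> 0" by (simp_all add: eqs)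
    moreover have "\<not> (proj_eq P U \<and> proj_eq P W)"
      using trans[of U W] 2 by (auto simp: UVW Finite_Cartesian_Product.vec_eq_iff forall_3 vector_3)
    ultimately show ?thesis using that on by blast
  next
    case 3
    then have "U \<noteq> 0" "V \<noteq> 0" by (simp_all add: eqs)
    moreover have "\<not> (proj_eq P U \<and> proj_eq P V)"
      using trans[of U V] 3 by (auto simp: UVW Finite_Cartesian_Product.vec_eq_iff forall_3 vector_3)
    ultimately show ?thesis using that on by blast
  qed
qed

lemma cuts_outD:
  assumes "cuts_out f l D" "P \<noteq> 0" "Q \<noteq> 0" "on_line l P" "on_line l Q" "\<not> proj_eq P Q"
  shows "restrict_line f P Q \<noteq> 0" "Polynomial.order 0 (restrict_line f P Q) = D P"
  using assms(1)[unfolded cuts_out_def, rule_format, of P Q] assms(2-) by simp_all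

lemma coeffs_below_order:
  assumes "p \<noteq> 0" "k < Polynomial.order 0 p"
  shows "Polynomial.coeff p k = (0 :: complex)"
  using monom_1_dvd_iff[OF assms(1), of "Polynomial.order 0 p"] monom_1_dvd_iff'[of "Polynomial.order 0 p" p] assms(2)
  by simp

text \<open>Order 4 leaves only the coefficient of \<open>v ^ 4\<close>, which is a square over the
  complex numbers.\<close>

lemma fourfold_contact_on_line:
  assumes "l \<noteq> 0" "P \<noteq> 0" "on_line l P" "cuts_out komiya_kuribayashi l D" "D P = 4"
  obtains Q C where "Q \<noteq> 0" "on_line l Q" "\<not> proj_eq P Q" "\<And>u v. kk (u *s P + v *s Q) = (C * v ^ 2) ^ 2"
proof -
  obtain Q where Q: "Q \<noteq> 0" "on_line l Q" "\<not> proj_eq P Q" by (rule exists_second_point[OF assms(1)])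
  obtain g0 g1 g2 g3 g4 where g: "restrict_line komiya_kuribayashi P Q = [:g0, g1, g2, g3, g4:]"
    and kk: "\<And>u v. kk (u *s P + v *s Q)
      = g0 * u ^ 4 + g1 * u ^ 3 * v + g2 * u ^ 2 * v ^ 2 + g3 * u * v ^ 3 + g4 * v ^ 4"
    by (rule restrict_line_komiya_kuribayashi[of P Q]) blast
  have "restrict_line komiya_kuribayashi P Q \<noteq> 0" "Polynomial.order 0 (restrict_line komiya_kuribayashi P Q) = 4"
    using cuts_outD[OF assms(4,2) Q(1) assms(3) Q(2,3)] assms(5) by simp_all
  from coeffs_below_order[OF this(1), unfolded this(2)]
  have "Polynomial.coeff [:g0, g1, g2, g3, g4:] k = 0" if "k < 4" for k using that by (simp add: g)
  from this[of 0] this[of 1] this[of 2] this[of 3] have "g0 = 0" "g1 = 0" "g2 = 0" "g3 = 0"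
    by (simp_all add: numeral_2_eq_2 numeral_3_eq_3)
  then have "kk (u *s P + v *s Q) = (csqrt g4 * v ^ 2) ^ 2" for u v
    by (simp add: kk power_mult_distrib flip: power_mult)
  then show ?thesis using that Q by blast
qed

text \<open>If the contact points differ, order 2 at both ends leaves only the term in
  \<open>u ^ 2 * v ^ 2\<close>; if they coincide, this is fourfold contact.\<close>

lemma bitangent_square:
  assumes "bitangent komiya_kuribayashi l"
  obtains P Q A B C where "P \<noteq> 0" "Q \<noteq> 0" "on_line l P" "on_line l Q" "\<not> proj_eq P Q"
    "\<And>u v. kk (u *s P + v *s Q) = (A * u ^ 2 + B * u * v + C * v ^ 2) ^ 2"
proof -
  obtain P P' where l: "l \<noteq> 0" and PP': "P \<noteq> 0" "P' \<noteq> 0" "on_line l P" "on_line l P'"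
    and cuts: "cuts_out komiya_kuribayashi l (\<lambda>R. 2 * point_divisor P R + 2 * point_divisor P' R)"
    using assms unfolding bitangent_def by blast
  show ?thesis
  proof (cases "proj_eq P P'")
    case True
    then have "2 * point_divisor P P + 2 * point_divisor P' P = 4"
      using proj_eq_sym[OF True] proj_eq_refl[of P] by (simp add: point_divisor_def)
    then obtain Q C where "Q \<noteq> 0" "on_line l Q" "\<not> proj_eq P Q" "\<And>u v. kk (u *s P + v *s Q) = (C * v ^ 2) ^ 2"
      using fourfold_contact_on_line[OF l PP'(1,3) cuts] by blast
    then show ?thesis using that[of P Q 0 0 C] PP' by simp
  next
    case False
    then have False': "\<not> proj_eq P' P" using proj_eq_sym by blast
    obtain g0 g1 g2 g3 g4 where g: "restrict_line komiya_kuribayashi P P' = [:g0, g1, g2, g3, g4:]"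
      and g': "restrict_line komiya_kuribayashi P' P = [:g4, g3, g2, g1, g0:]"
      and kk: "\<And>u v. kk (u *s P + v *s P')
        = g0 * u ^ 4 + g1 * u ^ 3 * v + g2 * u ^ 2 * v ^ 2 + g3 * u * v ^ 3 + g4 * v ^ 4"
      by (rule restrict_line_komiya_kuribayashi[of P P']) blast
    have "restrict_line komiya_kuribayashi P P' \<noteq> 0"
      "Polynomial.order 0 (restrict_line komiya_kuribayashi P P') = 2"
      using cuts_outD[OF cuts PP' False] False' proj_eq_refl[of P] by (simp_all add: point_divisor_def)
    from coeffs_below_order[OF this(1), unfolded this(2)]
    have "Polynomial.coeff [:g0, g1, g2, g3, g4:] k = 0" if "k < 2" for k using that by (simp add: g)
    from this[of 0] this[of 1] have *: "g0 = 0" "g1 = 0" by simp_all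
    have "restrict_line komiya_kuribayashi P' P \<noteq> 0"
      "Polynomial.order 0 (restrict_line komiya_kuribayashi P' P) = 2"
      using cuts_outD[OF cuts PP'(2,1,4,3) False'] False proj_eq_refl[of P'] by (simp_all add: point_divisor_def)
    from coeffs_below_order[OF this(1), unfolded this(2)]
    have "Polynomial.coeff [:g4, g3, g2, g1, g0:] k = 0" if "k < 2" for k using that by (simp add: g')
    from this[of 0] this[of 1] have "g4 = 0" "g3 = 0" by simp_all
    then have "kk (u *s P + v *s P') = (0 * u ^ 2 + csqrt g2 * u * v + 0 * v ^ 2) ^ 2" for u v
      by (simp add: kk * power_mult_distrib)
    then show ?thesis using that PP' False by blast
  qed
qed

lemma hyperosculating_square:
  assumes "hyperosculating komiya_kuribayashi l"
  obtains P Q C where "P \<noteq> 0" "Q \<noteq> 0" "on_line l P" "on_line l Q" "\<not> proj_eq P Q"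
    "\<And>u v. kk (u *s P + v *s Q) = (C * v ^ 2) ^ 2"
proof -
  obtain P where P: "l \<noteq> 0" "P \<noteq> 0" "on_line l P"
    and cuts: "cuts_out komiya_kuribayashi l (\<lambda>R. 4 * point_divisor P R)"
    using assms unfolding hyperosculating_def by blast
  have "4 * point_divisor P P = 4" using proj_eq_refl[of P] by (simp add: point_divisor_def)
  then show ?thesis using fourfold_contact_on_line[OF P cuts] that P by metis
qed

section \<open>Coefficients of the lines on which the quartic is a square\<close>

definition perm3 :: "3 \<Rightarrow> 3 \<Rightarrow> 3 \<Rightarrow> bool" where
  "perm3 i j k \<longleftrightarrow> i \<noteq> j \<and> i \<noteq> k \<and> j \<noteq> k"

lemma perm3_UNIV: "perm3 i j k \<Longrightarrow> UNIV = {i, j, k}"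
  using exhaust_3[of i] exhaust_3[of j] exhaust_3[of k] by (auto simp: perm3_def UNIV_3)

lemma perm3_sum: "perm3 i j k \<Longrightarrow> sum f UNIV = f i + f j + f k"
  by (simp add: perm3_UNIV perm3_def add.assoc)

lemma perm3_vec_eq: "perm3 i j k \<Longrightarrow> v = w \<longleftrightarrow> v $h i = w $h i \<and> v $h j = w $h j \<and> v $h k = w $h k"
  unfolding Finite_Cartesian_Product.vec_eq_iff using perm3_UNIV[of i j k] by (auto; metis UNIV_I insertE singletonD)

text \<open>The line is reparametrised by its coordinates x and y at i and j, the third being solved
  from the equation of the line. The discriminant is multiplied by the square of a nonzero
  determinant, so its vanishing is preserved.\<close>

lemma square_in_affine_coordinates:
  assumes ijk: "perm3 i j k" and lk: "l $h k \<noteq> 0"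
    and PQ: "P \<noteq> 0" "Q \<noteq> 0" "on_line l P" "on_line l Q" "\<not> proj_eq P Q"
    and kk: "\<And>u v. kk (u *s P + v *s Q) = (A * u ^ 2 + B * u * v + C * v ^ 2) ^ 2"
  obtains A' B' C' where
    "\<And>x y. 2 * (A' * x ^ 2 + B' * x * y + C' * y ^ 2) ^ 2
      = 3 * (x ^ 2 + y ^ 2 + (l $h i / l $h k * x + l $h j / l $h k * y) ^ 2) ^ 2
        - (x ^ 4 + y ^ 4 + (l $h i / l $h k * x + l $h j / l $h k * y) ^ 4)"
    "B' ^ 2 - 4 * A' * C' = 0 \<longleftrightarrow> B ^ 2 - 4 * A * C = 0"
proof -
  define a b where "a = - l $h i / l $h k" and "b = - l $h j / l $h k"
  have Pk: "P $h k = a * P $h i + b * P $h j" and Qk: "Q $h k = a * Q $h i + b * Q $h j"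
    using PQ(3,4) lk unfolding on_line_def perm3_sum[OF ijk]
    by (simp_all add: a_def b_def field_simps eq_neg_iff_add_eq_0)
  define \<Delta> where "\<Delta> = P $h i * Q $h j - P $h j * Q $h i"
  \<comment> \<open>The coordinates at k are determined by the other two, so a zero minor would make
    P and Q the same projective point.\<close>
  have "\<Delta> \<noteq> 0"
  proof
    assume 0: "\<Delta> = 0"
    have "\<exists>c. Q = c *s P"
    proof (cases "P $h i = 0")
      case True
      have "P $h j \<noteq> 0"
        using PQ(1) True Pk perm3_vec_eq[OF ijk, of P 0] by auto
      then show ?thesis using 0 True unfolding perm3_vec_eq[OF ijk]
        by (intro exI[of _ "Q $h j / P $h j"]) (auto simp: Pk Qk \<Delta>_def field_simps)
    next
      case False
      then show ?thesis using 0 unfolding perm3_vec_eq[OF ijk]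
        by (intro exI[of _ "Q $h i / P $h i"]) (auto simp: Pk Qk \<Delta>_def field_simps)
    qed
    then obtain c where "Q = c *s P" by blast
    moreover have "c \<noteq> 0" using PQ(2) calculation by auto
    ultimately show False using PQ(5) unfolding proj_eq_def by blast
  qed
  define u1 u2 v1 v2 where "u1 = Q $h j / \<Delta>" and "u2 = - Q $h i / \<Delta>"
    and "v1 = - P $h j / \<Delta>" and "v2 = P $h i / \<Delta>"
  note uv = u1_def u2_def v1_def v2_def
  define A' where "A' = A * u1 ^ 2 + B * u1 * v1 + C * v1 ^ 2"
  define B' where "B' = 2 * A * u1 * u2 + B * (u1 * v2 + u2 * v1) + 2 * C * v1 * v2"
  define C' where "C' = A * u2 ^ 2 + B * u2 * v2 + C * v2 ^ 2"
  have "u1 * v2 - u2 * v1 = 1 / \<Delta>"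
  proof -
    have "u1 * v2 - u2 * v1 = (P $h i * Q $h j - P $h j * Q $h i) / (\<Delta> * \<Delta>)"
      using \<open>\<Delta> \<noteq> 0\<close> by (simp add: uv field_simps)
    then show ?thesis using \<open>\<Delta> \<noteq> 0\<close> by (simp flip: \<Delta>_def)
  qed
  moreover have "B' ^ 2 - 4 * A' * C' = (B ^ 2 - 4 * A * C) * (u1 * v2 - u2 * v1) ^ 2"
    by (simp add: A'_def B'_def C'_def algebra_simps power2_eq_square)
  ultimately have disc: "B' ^ 2 - 4 * A' * C' = 0 \<longleftrightarrow> B ^ 2 - 4 * A * C = 0"
    using \<open>\<Delta> \<noteq> 0\<close> by simp
  have "2 * (A' * x ^ 2 + B' * x * y + C' * y ^ 2) ^ 2
      = 3 * (x ^ 2 + y ^ 2 + (a * x + b * y) ^ 2) ^ 2 - (x ^ 4 + y ^ 4 + (a * x + b * y) ^ 4)" for x y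
  proof -
    define R where "R = (u1 * x + u2 * y) *s P + (v1 * x + v2 * y) *s Q"
    have Ri: "R $h i = x" and Rj: "R $h j = y"
    proof -
      have "R $h i * \<Delta> = x * (P $h i * Q $h j - P $h j * Q $h i)"
        "R $h j * \<Delta> = y * (P $h i * Q $h j - P $h j * Q $h i)"
        using \<open>\<Delta> \<noteq> 0\<close> by (simp_all add: R_def uv field_simps)
      then show "R $h i = x" "R $h j = y" using \<open>\<Delta> \<noteq> 0\<close> by (simp_all flip: \<Delta>_def)
    qed
    have "R $h k = a * R $h i + b * R $h j" by (simp add: R_def Pk Qk algebra_simps)
    then have "2 * kk R = 3 * (x ^ 2 + y ^ 2 + (a * x + b * y) ^ 2) ^ 2 - (x ^ 4 + y ^ 4 + (a * x + b * y) ^ 4)"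
      unfolding kk_def perm3_sum[OF ijk] by (simp add: Ri Rj)
    moreover have "kk R = (A' * x ^ 2 + B' * x * y + C' * y ^ 2) ^ 2"
      unfolding R_def kk
      by (rule arg_cong[of _ _ "\<lambda>w. w ^ 2"]) (simp add: A'_def B'_def C'_def algebra_simps power2_eq_square)
    ultimately show ?thesis by simp
  qed
  moreover have "a * x + b * y = - (l $h i / l $h k * x + l $h j / l $h k * y)" for x y
    by (simp add: a_def b_def)
  ultimately show ?thesis using that[OF _ disc] by (simp only: power_minus_even even_numeral even_two_times_div_two)
qed

lemma quartic_form_zero:
  fixes c0 c1 c2 c3 c4 :: complex
  assumes "\<And>x y. c0 * x ^ 4 + c1 * x ^ 3 * y + c2 * x ^ 2 * y ^ 2 + c3 * x * y ^ 3 + c4 * y ^ 4 = 0"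
  shows "c0 = 0" "c1 = 0" "c2 = 0" "c3 = 0" "c4 = 0"
proof -
  show c0: "c0 = 0" and c4: "c4 = 0" using assms[of 1 0] assms[of 0 1] by simp_all
  have s: "c1 + c2 + c3 = 0" "- c1 + c2 - c3 = 0" "2 * c1 + 4 * c2 + 8 * c3 = 0"
    using assms[of 1 1] assms[of 1 "- 1"] assms[of 1 2] c0 c4 by (simp_all add: algebra_simps)
  have "2 * c2 = (c1 + c2 + c3) + (- c1 + c2 - c3)" by simp
  then show c2: "c2 = 0" unfolding s by simp
  have "6 * c3 = (2 * c1 + 4 * c2 + 8 * c3) - 2 * (c1 + c2 + c3) - 2 * c2" by simp
  then show c3: "c3 = 0" unfolding s by (simp add: c2)
  show "c1 = 0" using s(1) c2 c3 by simp
qed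

lemma square_coefficients:
  fixes a b A B C :: complex
  assumes sq: "\<And>x y. 2 * (A * x ^ 2 + B * x * y + C * y ^ 2) ^ 2
      = 3 * (x ^ 2 + y ^ 2 + (a * x + b * y) ^ 2) ^ 2 - (x ^ 4 + y ^ 4 + (a * x + b * y) ^ 4)"
  shows "A ^ 2 = (a ^ 2) ^ 2 + 3 * a ^ 2 + 1" "A * B = a * b * (2 * a ^ 2 + 3)"
    "B ^ 2 + 2 * A * C = 6 * a ^ 2 * b ^ 2 + 3 * a ^ 2 + 3 * b ^ 2 + 3"
    "B * C = a * b * (2 * b ^ 2 + 3)" "C ^ 2 = (b ^ 2) ^ 2 + 3 * b ^ 2 + 1"
proof -
  have "(A ^ 2 - ((a ^ 2) ^ 2 + 3 * a ^ 2 + 1)) * x ^ 4 + 2 * (A * B - a * b * (2 * a ^ 2 + 3)) * x ^ 3 * y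
      + (B ^ 2 + 2 * A * C - (6 * a ^ 2 * b ^ 2 + 3 * a ^ 2 + 3 * b ^ 2 + 3)) * x ^ 2 * y ^ 2
      + 2 * (B * C - a * b * (2 * b ^ 2 + 3)) * x * y ^ 3
      + (C ^ 2 - ((b ^ 2) ^ 2 + 3 * b ^ 2 + 1)) * y ^ 4 = 0" (is "?L = 0") for x y
  proof -
    have "2 * ?L = 2 * (A * x ^ 2 + B * x * y + C * y ^ 2) ^ 2
        - (3 * (x ^ 2 + y ^ 2 + (a * x + b * y) ^ 2) ^ 2 - (x ^ 4 + y ^ 4 + (a * x + b * y) ^ 4))"
      by (simp add: algebra_simps eval_nat_numeral)
    then have "2 * ?L = 0" unfolding sq by simp
    then show ?thesis by (metis mult_eq_0_iff zero_neq_numeral)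
  qed
  from quartic_form_zero[OF this] show "A ^ 2 = (a ^ 2) ^ 2 + 3 * a ^ 2 + 1" "A * B = a * b * (2 * a ^ 2 + 3)"
    "B ^ 2 + 2 * A * C = 6 * a ^ 2 * b ^ 2 + 3 * a ^ 2 + 3 * b ^ 2 + 3"
    "B * C = a * b * (2 * b ^ 2 + 3)" "C ^ 2 = (b ^ 2) ^ 2 + 3 * b ^ 2 + 1"
    by simp_all
qed

text \<open>This is the case of a line through a coordinate point: the mixed coefficients force
  \<open>B = 0\<close>, and \<open>(2 * A * C) ^ 2 = 4 * A ^ 2 * C ^ 2\<close> leaves a quadratic in
  u. A zero discriminant would give \<open>u = - 1\<close>, which is not a root.\<close>

lemma square_coefficients_axis:
  fixes A B C u :: complex
  assumes "C ^ 2 = 1" "B * C = 0" "B ^ 2 + 2 * A * C = 3 * u + 3" "A ^ 2 = u ^ 2 + 3 * u + 1"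
  shows "5 * u ^ 2 + 6 * u + 5 = 0" "B ^ 2 - 4 * A * C \<noteq> 0"
proof -
  have "B = 0" using assms(1,2) by auto
  then have AC: "2 * A * C = 3 * u + 3" using assms(3) by simp
  have "(2 * A * C) ^ 2 = 4 * A ^ 2 * C ^ 2" by (simp add: power_mult_distrib)
  then have "(3 * u + 3) ^ 2 = 4 * (u ^ 2 + 3 * u + 1)" unfolding AC assms by simp
  then show q: "5 * u ^ 2 + 6 * u + 5 = 0"
    by (simp add: power2_eq_square algebra_simps)
  show "B ^ 2 - 4 * A * C \<noteq> 0"
  proof
    assume "B ^ 2 - 4 * A * C = 0"
    then have "3 * u + 3 = 0" using AC \<open>B = 0\<close> by auto
    then have "u = - 1" by (metis add.commute add_eq_0_iff distrib_left_numeral mult.right_neutral mult_eq_0_iff zero_neq_numeral)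
    then show False using q by simp
  qed
qed

text \<open>The unknowns A, B, C are eliminated in favour of the squares u and v. The first three
  alternatives are the hyperosculating lines; all others come with a nonzero discriminant.\<close>

lemma square_coefficients_classification:
  fixes a b A B C :: complex
  defines "u \<equiv> a ^ 2" and "v \<equiv> b ^ 2"
  assumes A: "A ^ 2 = u ^ 2 + 3 * u + 1" and AB: "A * B = a * b * (2 * u + 3)"
    and BAC: "B ^ 2 + 2 * A * C = 6 * u * v + 3 * u + 3 * v + 3"
    and BC: "B * C = a * b * (2 * v + 3)" and C: "C ^ 2 = v ^ 2 + 3 * v + 1"
  shows "(4 * u = - 1 \<and> 4 * v = - 1) \<or> (u = 1 \<and> v = - 4) \<or> (u = - 4 \<and> v = 1)
    \<or> B ^ 2 - 4 * A * C \<noteq> 0 \<and> ((u = 1 \<and> v = 1)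
       \<or> (u = 0 \<and> 5 * v ^ 2 + 6 * v + 5 = 0) \<or> (v = 0 \<and> 5 * u ^ 2 + 6 * u + 5 = 0))"
proof (cases "u = 0 \<or> v = 0")
  case True
  then consider "v = 0" | "u = 0" by blast
  then show ?thesis
  proof cases
    case 1
    then have "b = 0" by (simp add: v_def)
    with 1 show ?thesis using square_coefficients_axis[of C B A u] A BAC BC C by simp
  next
    case 2
    then have "a = 0" by (simp add: u_def)
    with 2 show ?thesis
      using square_coefficients_axis[of A B C v] A BAC AB C by (simp add: mult_ac)
  qed
next
  case False
  then have uv: "u \<noteq> 0" "v \<noteq> 0" by auto
  have ab: "(a * b) ^ 2 = u * v" by (simp add: u_def v_def power_mult_distrib)
  have AB2: "A ^ 2 * B ^ 2 = u * v * (2 * u + 3) ^ 2"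
    using arg_cong[OF AB, of "\<lambda>w. w ^ 2"] by (simp add: power_mult_distrib ab[unfolded power_mult_distrib])
  have BC2: "B ^ 2 * C ^ 2 = u * v * (2 * v + 3) ^ 2"
    using arg_cong[OF BC, of "\<lambda>w. w ^ 2"] by (simp add: power_mult_distrib ab[unfolded power_mult_distrib])
  \<comment> \<open>Computing \<open>A ^ 2 * B ^ 2 * C ^ 2\<close> in two ways removes A, B and C,
    and the result factors as \<open>5 * ((v - u) * (u + v + 3))\<close>.\<close>
  have "u * v * ((2 * u + 3) ^ 2 * C ^ 2) = u * v * ((2 * v + 3) ^ 2 * A ^ 2)"
  proof -
    have "u * v * ((2 * u + 3) ^ 2 * C ^ 2) = (A ^ 2 * B ^ 2) * C ^ 2" unfolding AB2 by (simp only: mult_ac)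
    also have "\<dots> = (B ^ 2 * C ^ 2) * A ^ 2" by (simp only: mult_ac)
    also have "\<dots> = u * v * ((2 * v + 3) ^ 2 * A ^ 2)" unfolding BC2 by (simp only: mult_ac)
    finally show ?thesis .
  qed
  then have "(2 * u + 3) ^ 2 * (v ^ 2 + 3 * v + 1) - (2 * v + 3) ^ 2 * (u ^ 2 + 3 * u + 1) = 0"
    using uv A C by simp
  moreover have "(2 * u + 3) ^ 2 * (v ^ 2 + 3 * v + 1) - (2 * v + 3) ^ 2 * (u ^ 2 + 3 * u + 1)
      = 5 * ((v - u) * (u + v + 3))"
    by (simp add: power2_eq_square algebra_simps)
  ultimately have "v = u \<or> u + v + 3 = 0" by auto
  moreover have "B \<noteq> 0"
  proof
    assume "B = 0"
    then have "2 * u + 3 = 0" "2 * v + 3 = 0" using AB BC uv by (auto simp: u_def v_def)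
    then have uv: "u = - (3 / 2)" "v = - (3 / 2)" by (simp_all add: eq_neg_iff_add_eq_0 field_simps)
    have "(2 * A * C) ^ 2 = 4 * A ^ 2 * C ^ 2" by (simp add: power_mult_distrib)
    moreover have "2 * A * C = 15 / 2" using BAC \<open>B = 0\<close> by (simp add: uv)
    ultimately show False unfolding A C by (simp add: uv power2_eq_square)
  qed
  ultimately consider "v = u" | "v = - 3 - u" by (auto simp: algebra_simps eq_neg_iff_add_eq_0)
  then show ?thesis
  proof cases
    case 1
    \<comment> \<open>On each of the two branches the products with B fix C as A or -A. Then
      \<open>B ^ 2\<close> is a polynomial in u, and \<open>AB2\<close> becomes a quadratic equation
      for u.\<close>
    have "A * B = C * B" using BC unfolding AB 1 by (simp only: mult.commute[of C])
    then have "A = C" using \<open>B \<noteq> 0\<close> by simp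
    have "B ^ 2 = (B ^ 2 + 2 * A * C) - 2 * A ^ 2" using \<open>A = C\<close> by (simp add: power2_eq_square)
    then have B2: "B ^ 2 = 4 * u ^ 2 + 1"
      unfolding BAC A 1 by (simp add: power2_eq_square algebra_simps)
    have "(u ^ 2 + 3 * u + 1) * (4 * u ^ 2 + 1) - u * u * (2 * u + 3) ^ 2 = 0"
      using AB2 unfolding A B2 1 by simp
    moreover have "(u ^ 2 + 3 * u + 1) * (4 * u ^ 2 + 1) - u * u * (2 * u + 3) ^ 2 = (4 * u + 1) * (1 - u)"
      by (simp add: power2_eq_square algebra_simps)
    ultimately have "4 * u = - 1 \<or> u = 1" by (auto simp: eq_neg_iff_add_eq_0)
    moreover have "B ^ 2 - 4 * A * C \<noteq> 0" if "u = 1"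
    proof -
      have "B ^ 2 - 4 * A * C = 5 - 4 * A ^ 2" using B2 that \<open>A = C\<close> by (simp add: power2_eq_square)
      then show ?thesis using A that by simp
    qed
    ultimately show ?thesis using 1 by blast
  next
    case 2
    have "B * C = - (A * B)" unfolding AB BC 2 by (simp add: algebra_simps)
    then have "C = - A" using \<open>B \<noteq> 0\<close> by (metis mult.commute mult_cancel_left mult_minus_left)
    have "B ^ 2 = (B ^ 2 + 2 * A * C) + 2 * A ^ 2" using \<open>C = - A\<close> by (simp add: power2_eq_square)
    then have B2: "B ^ 2 = - 4 * (u ^ 2 + 3 * u + 1)"
      unfolding BAC A 2 by (simp add: power2_eq_square algebra_simps)
    have "(u ^ 2 + 3 * u + 1) * (- 4 * (u ^ 2 + 3 * u + 1)) - u * (- 3 - u) * (2 * u + 3) ^ 2 = 0"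
      using AB2 unfolding A B2 2 by simp
    moreover have "(u ^ 2 + 3 * u + 1) * (- 4 * (u ^ 2 + 3 * u + 1)) - u * (- 3 - u) * (2 * u + 3) ^ 2
        = (u - 1) * (u + 4)"
      by (simp add: power2_eq_square algebra_simps)
    ultimately have "u = 1 \<or> u = - 4" by (auto simp: eq_neg_iff_add_eq_0)
    then show ?thesis using 2 by auto
  qed
qed

section \<open>Normal forms of the lines and their concurrency\<close>

definition hyperflex_type :: "complex \<Rightarrow> complex \<Rightarrow> complex \<Rightarrow> bool" where
  "hyperflex_type x y z \<longleftrightarrow> (x ^ 2 = y ^ 2 \<and> z ^ 2 = - 4 * x ^ 2) \<or> (x ^ 2 = z ^ 2 \<and> y ^ 2 = - 4 * x ^ 2)
     \<or> (y ^ 2 = z ^ 2 \<and> x ^ 2 = - 4 * y ^ 2)"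

definition axis_type :: "complex \<Rightarrow> complex \<Rightarrow> complex \<Rightarrow> bool" where
  "axis_type x y z \<longleftrightarrow> (x = 0 \<and> 5 * (y ^ 2) ^ 2 + 6 * y ^ 2 * z ^ 2 + 5 * (z ^ 2) ^ 2 = 0)
     \<or> (y = 0 \<and> 5 * (x ^ 2) ^ 2 + 6 * x ^ 2 * z ^ 2 + 5 * (z ^ 2) ^ 2 = 0)
     \<or> (z = 0 \<and> 5 * (x ^ 2) ^ 2 + 6 * x ^ 2 * y ^ 2 + 5 * (y ^ 2) ^ 2 = 0)"

text \<open>These conditions are homogeneous and involve only squares and a symmetric disjunction,
  so they do not depend on the affine chart and survive permutations and sign changes.\<close>

definition bitangent_type :: "complex \<Rightarrow> complex \<Rightarrow> complex \<Rightarrow> bool" where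
  "bitangent_type x y z \<longleftrightarrow> hyperflex_type x y z \<or> (x ^ 2 = y ^ 2 \<and> y ^ 2 = z ^ 2) \<or> axis_type x y z"

text \<open>The exceptional coordinate is normalised to 2i, so a line is a multiple of a listed
  triple. Equal triples give equal lines, hence distinctness of lines becomes plain inequality of
  triples.\<close>

definition hyperflex_lines :: "(complex \<times> complex \<times> complex) set" where
  "hyperflex_lines = {(2 * \<i>, 1, 1), (2 * \<i>, 1, - 1), (2 * \<i>, - 1, 1), (2 * \<i>, - 1, - 1),
     (1, 2 * \<i>, 1), (1, 2 * \<i>, - 1), (- 1, 2 * \<i>, 1), (- 1, 2 * \<i>, - 1),
     (1, 1, 2 * \<i>), (1, - 1, 2 * \<i>), (- 1, 1, 2 * \<i>), (- 1, - 1, 2 * \<i>)}"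

definition diagonal_lines :: "(complex \<times> complex \<times> complex) set" where
  "diagonal_lines = {(1, 1, 1), (1, - 1, 1), (- 1, 1, 1), (- 1, - 1, 1)}"

text \<open>The determinant of the lines (1, 1, 2i), n and b.\<close>

definition meet_det :: "complex \<times> complex \<times> complex \<Rightarrow> complex \<times> complex \<times> complex \<Rightarrow> complex" where
  "meet_det n b = (case n of (n1, n2, n3) \<Rightarrow> case b of (b1, b2, b3) \<Rightarrow>
     (n3 - 2 * \<i> * n2) * b1 + (2 * \<i> * n1 - n3) * b2 + (n2 - n1) * b3)"

lemma square_eq_signs: "x ^ 2 = y ^ 2 \<Longrightarrow> x = y \<or> x = - (y :: complex)"
  by (simp add: power2_eq_iff)

lemma square_eq_minus_four: "z ^ 2 = - 4 * x ^ 2 \<Longrightarrow> x = z / (2 * \<i>) \<or> x = - (z / (2 * \<i>))" for x z :: complex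
proof -
  assume "z ^ 2 = - 4 * x ^ 2"
  then have "x ^ 2 = (z / (2 * \<i>)) ^ 2" by (simp add: power_divide power_mult_distrib field_simps)
  then show ?thesis by (rule square_eq_signs)
qed

lemma hyperflex_scaling:
  fixes p q w :: complex
  assumes "p ^ 2 = q ^ 2" "w ^ 2 = - 4 * p ^ 2" "p \<noteq> 0 \<or> q \<noteq> 0 \<or> w \<noteq> 0"
  obtains \<beta> s t where "\<beta> \<noteq> 0" "s = 1 \<or> s = - 1" "t = 1 \<or> t = - 1"
    "p = \<beta> * s" "q = \<beta> * t" "w = \<beta> * (2 * \<i>)"
proof -
  define \<beta> where "\<beta> = w / (2 * \<i>)"
  have p: "p = \<beta> \<or> p = - \<beta>" using square_eq_minus_four[OF assms(2)] by (simp add: \<beta>_def)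
  moreover have q: "q = p \<or> q = - p" using square_eq_signs[OF assms(1)] by auto
  ultimately have q': "q = \<beta> \<or> q = - \<beta>" by auto
  have "2 * \<i> \<noteq> 0" by simp
  then have w: "w = \<beta> * (2 * \<i>)" by (metis \<beta>_def nonzero_divide_eq_eq)
  have "\<beta> \<noteq> 0" using p q' w assms(3) by auto
  from p obtain s where "s = 1 \<or> s = - 1" "p = \<beta> * s"
    by (metis mult.right_neutral mult_minus1_right)
  moreover from q' obtain t where "t = 1 \<or> t = - 1" "q = \<beta> * t"
    by (metis mult.right_neutral mult_minus1_right)
  ultimately show ?thesis using that w \<open>\<beta> \<noteq> 0\<close> by blast
qed

lemma hyperflex_normal_form:
  assumes "hyperflex_type x y z" "x \<noteq> 0 \<or> y \<noteq> 0 \<or> z \<noteq> 0"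
  obtains \<beta> p q r where "\<beta> \<noteq> 0" "(p, q, r) \<in> hyperflex_lines" "x = \<beta> * p" "y = \<beta> * q" "z = \<beta> * r"
proof -
  from assms(1) consider "x ^ 2 = y ^ 2" "z ^ 2 = - 4 * x ^ 2" | "x ^ 2 = z ^ 2" "y ^ 2 = - 4 * x ^ 2"
    | "y ^ 2 = z ^ 2" "x ^ 2 = - 4 * y ^ 2" unfolding hyperflex_type_def by blast
  then show ?thesis
  proof cases
    case 1
    obtain \<beta> s t where *: "\<beta> \<noteq> 0" "s = 1 \<or> s = - 1" "t = 1 \<or> t = - 1"
      "x = \<beta> * s" "y = \<beta> * t" "z = \<beta> * (2 * \<i>)"
      using hyperflex_scaling[OF 1] assms(2) by blast
    have "(s, t, 2 * \<i>) \<in> hyperflex_lines" using *(2,3) by (auto simp: hyperflex_lines_def)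
    then show ?thesis by (rule that[OF *(1) _ *(4-6)])
  next
    case 2
    obtain \<beta> s t where *: "\<beta> \<noteq> 0" "s = 1 \<or> s = - 1" "t = 1 \<or> t = - 1"
      "x = \<beta> * s" "z = \<beta> * t" "y = \<beta> * (2 * \<i>)"
      using hyperflex_scaling[OF 2] assms(2) by blast
    have "(s, 2 * \<i>, t) \<in> hyperflex_lines" using *(2,3) by (auto simp: hyperflex_lines_def)
    then show ?thesis by (rule that[OF *(1) _ *(4,6,5)])
  next
    case 3
    obtain \<beta> s t where *: "\<beta> \<noteq> 0" "s = 1 \<or> s = - 1" "t = 1 \<or> t = - 1"
      "y = \<beta> * s" "z = \<beta> * t" "x = \<beta> * (2 * \<i>)"
      using hyperflex_scaling[OF 3] assms(2) by blast
    have "(2 * \<i>, s, t) \<in> hyperflex_lines" using *(2,3) by (auto simp: hyperflex_lines_def)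
    then show ?thesis by (rule that[OF *(1) _ *(6,4,5)])
  qed
qed

lemma diagonal_normal_form:
  assumes "x ^ 2 = y ^ 2" "y ^ 2 = z ^ 2" "x \<noteq> 0 \<or> y \<noteq> 0 \<or> z \<noteq> (0 :: complex)"
  obtains \<beta> p q r where "\<beta> \<noteq> 0" "(p, q, r) \<in> diagonal_lines" "x = \<beta> * p" "y = \<beta> * q" "z = \<beta> * r"
proof -
  have "y = z \<or> y = - z" "x = z \<or> x = - z" using square_eq_signs assms(1,2) by auto
  moreover from this have "z \<noteq> 0" using assms(3) by auto
  ultimately show ?thesis
    using that[of z 1 1 1] that[of z 1 "- 1" 1] that[of z "- 1" 1 1] that[of z "- 1" "- 1" 1]
    by (auto simp: diagonal_lines_def)
qed

text \<open>A finite check. The third line ranges over \<open>hyperflex_lines\<close> too, because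
  hyperosculating lines count as bitangents.\<close>

lemma det_lines:
  "\<forall>n\<in>hyperflex_lines. \<forall>b\<in>hyperflex_lines \<union> diagonal_lines.
    n \<noteq> (1, 1, 2 * \<i>) \<longrightarrow> b \<noteq> (1, 1, 2 * \<i>) \<longrightarrow> b \<noteq> n \<longrightarrow> meet_det n b = 0 \<longrightarrow>
    n = (- 1, - 1, 2 * \<i>) \<and> (b = (1, 1, 1) \<or> b = (- 1, - 1, 1))"
  unfolding hyperflex_lines_def diagonal_lines_def ball_Un by (simp add: meet_det_def complex_eq_iff)

text \<open>The slopes of these lines are not Gaussian rational, so there is no finite list to
  evaluate. Concurrency is a linear equation with Gaussian integer coefficients; with one coordinate
  zero it fixes the ratio of the other two, and the symmetric form 5p^2 + 6pq + 5q^2 would then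
  vanish at the squares of two coefficients, which direct evaluation excludes.\<close>

lemma det_axis:
  assumes "n \<in> hyperflex_lines" "n \<noteq> (1, 1, 2 * \<i>)" "axis_type x y z" "x \<noteq> 0 \<or> y \<noteq> 0 \<or> z \<noteq> 0"
  shows "meet_det n (x, y, z) \<noteq> 0"
proof
  assume det: "meet_det n (x, y, z) = 0"
  obtain n1 n2 n3 where n: "n = (n1, n2, n3)" by (cases n)
  define N1 N2 N3 where "N1 = n3 - 2 * \<i> * n2" and "N2 = 2 * \<i> * n1 - n3" and "N3 = n2 - n1"
  have N: "N1 * x + N2 * y + N3 * z = 0" using det by (simp add: meet_det_def n N1_def N2_def N3_def)
  have nz: "5 * (N2 ^ 2) ^ 2 + 6 * N2 ^ 2 * N3 ^ 2 + 5 * (N3 ^ 2) ^ 2 \<noteq> 0"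
    "5 * (N1 ^ 2) ^ 2 + 6 * N1 ^ 2 * N3 ^ 2 + 5 * (N3 ^ 2) ^ 2 \<noteq> 0"
    "5 * (N1 ^ 2) ^ 2 + 6 * N1 ^ 2 * N2 ^ 2 + 5 * (N2 ^ 2) ^ 2 \<noteq> 0"
    using assms(1,2) unfolding n hyperflex_lines_def N1_def N2_def N3_def
    by (auto simp: complex_eq_iff eval_nat_numeral)
  have *: "u = 0 \<and> w = 0"
    if uw: "5 * (u ^ 2) ^ 2 + 6 * u ^ 2 * w ^ 2 + 5 * (w ^ 2) ^ 2 = 0" and L: "L * u + M * w = 0"
      and LM: "5 * (L ^ 2) ^ 2 + 6 * L ^ 2 * M ^ 2 + 5 * (M ^ 2) ^ 2 \<noteq> 0" for u w L M :: complex
  proof -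
    have Lu: "L * u = - (M * w)" using L by (simp add: eq_neg_iff_add_eq_0)
    have "(L * u) ^ 2 = (M * w) ^ 2" unfolding Lu by simp
    then have 2: "L ^ 2 * u ^ 2 = M ^ 2 * w ^ 2" by (simp add: power_mult_distrib)
    have "(5 * (L ^ 2) ^ 2 + 6 * L ^ 2 * M ^ 2 + 5 * (M ^ 2) ^ 2) * (w ^ 2) ^ 2
        = (L ^ 2) ^ 2 * (5 * (u ^ 2) ^ 2 + 6 * u ^ 2 * w ^ 2 + 5 * (w ^ 2) ^ 2)
          + 6 * L ^ 2 * w ^ 2 * (M ^ 2 * w ^ 2 - L ^ 2 * u ^ 2)
          + 5 * (M ^ 2 * w ^ 2 - L ^ 2 * u ^ 2) * (M ^ 2 * w ^ 2 + L ^ 2 * u ^ 2)"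
      by (simp add: algebra_simps power2_eq_square)
    then have w: "w = 0" using LM unfolding uw 2 by simp
    then show ?thesis using uw by simp
  qed
  from assms(3) consider
      "x = 0" "5 * (y ^ 2) ^ 2 + 6 * y ^ 2 * z ^ 2 + 5 * (z ^ 2) ^ 2 = 0"
    | "y = 0" "5 * (x ^ 2) ^ 2 + 6 * x ^ 2 * z ^ 2 + 5 * (z ^ 2) ^ 2 = 0"
    | "z = 0" "5 * (x ^ 2) ^ 2 + 6 * x ^ 2 * y ^ 2 + 5 * (y ^ 2) ^ 2 = 0"
    unfolding axis_type_def by blast
  then show False
  proof cases
    case 1 then show False using *[OF 1(2) _ nz(1)] N assms(4) by simp
  next
    case 2 then show False using *[OF 2(2) _ nz(2)] N assms(4) by simp
  next
    case 3 then show False using *[OF 3(2) _ nz(3)] N assms(4) by simp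
  qed
qed

lemma perm3_cases:
  assumes "perm3 i j k"
  shows "(i, j, k) \<in> {(1, 2, 3), (1, 3, 2), (2, 1, 3), (2, 3, 1), (3, 1, 2), (3, 2, 1)}"
  using assms exhaust_3[of i] exhaust_3[of j] exhaust_3[of k] by (auto simp: perm3_def)

lemma hyperflex_type_swap:
  "hyperflex_type x y z = hyperflex_type y x z" "hyperflex_type x y z = hyperflex_type x z y"
  by (auto simp: hyperflex_type_def)

lemma axis_type_swap: "axis_type x y z = axis_type y x z" "axis_type x y z = axis_type x z y"
  by (auto simp: axis_type_def algebra_simps)

lemma bitangent_type_swap:
  "bitangent_type x y z = bitangent_type y x z" "bitangent_type x y z = bitangent_type x z y"
proof -
  show "bitangent_type x y z = bitangent_type y x z"
    by (auto simp: bitangent_type_def hyperflex_type_swap(1)[of x y z] axis_type_swap(1)[of x y z])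
  show "bitangent_type x y z = bitangent_type x z y"
    by (auto simp: bitangent_type_def hyperflex_type_swap(2)[of x y z] axis_type_swap(2)[of x y z])
qed

lemma swap_invariant_perm3:
  assumes swap: "\<And>x y z. R x y z = R y x z" "\<And>x y z. R x y z = R x z y" and "perm3 i j k"
  shows "R (v i) (v j) (v k) = R (v 1) (v 2) (v 3)"
  using perm3_cases[OF assms(3)] by (auto intro: swap) (metis swap)+

lemma bitangent_classification:
  assumes "perm3 i j k" "l $h k \<noteq> 0"
    and "P \<noteq> 0" "Q \<noteq> 0" "on_line l P" "on_line l Q" "\<not> proj_eq P Q"
    and "\<And>u v. kk (u *s P + v *s Q) = (A * u ^ 2 + B * u * v + C * v ^ 2) ^ 2"
  shows "bitangent_type (l $h i) (l $h j) (l $h k)"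
    and "B ^ 2 - 4 * A * C = 0 \<Longrightarrow> hyperflex_type (l $h i) (l $h j) (l $h k)"
proof -
  define a b c where "a = l $h i / l $h k" and "b = l $h j / l $h k" and "c = l $h k"
  obtain A' B' C' where sq: "\<And>x y. 2 * (A' * x ^ 2 + B' * x * y + C' * y ^ 2) ^ 2
      = 3 * (x ^ 2 + y ^ 2 + (a * x + b * y) ^ 2) ^ 2 - (x ^ 4 + y ^ 4 + (a * x + b * y) ^ 4)"
    and disc: "B' ^ 2 - 4 * A' * C' = 0 \<longleftrightarrow> B ^ 2 - 4 * A * C = 0"
    unfolding a_def b_def by (rule square_in_affine_coordinates[OF assms]) blast
  note classification = square_coefficients_classification[OF square_coefficients[OF sq]]
  have l: "l $h i = a * c" "l $h j = b * c" "l $h k = c" using assms(2) by (simp_all add: a_def b_def c_def)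
  have hyp: "hyperflex_type (a * c) (b * c) c"
    if "(4 * a ^ 2 = - 1 \<and> 4 * b ^ 2 = - 1) \<or> (a ^ 2 = 1 \<and> b ^ 2 = - 4) \<or> (a ^ 2 = - 4 \<and> b ^ 2 = 1)"
    using that
  proof (elim disjE conjE)
    assume q: "4 * a ^ 2 = - 1" "4 * b ^ 2 = - 1"
    then have "4 * a ^ 2 = 4 * b ^ 2" by simp
    then have "a ^ 2 = b ^ 2" by simp
    moreover have "- 4 * (a * c) ^ 2 = - (4 * a ^ 2) * c ^ 2" by (simp add: power_mult_distrib)
    ultimately show ?thesis by (simp add: hyperflex_type_def power_mult_distrib q)
  qed (auto simp: hyperflex_type_def power_mult_distrib)
  have ax: "5 * ((w * c) ^ 2) ^ 2 + 6 * (w * c) ^ 2 * c ^ 2 + 5 * (c ^ 2) ^ 2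
      = (5 * (w ^ 2) ^ 2 + 6 * w ^ 2 + 5) * c ^ 4" for w
    by (simp add: algebra_simps eval_nat_numeral)
  have axis: "axis_type (a * c) (b * c) c"
    if "(a ^ 2 = 0 \<and> 5 * (b ^ 2) ^ 2 + 6 * b ^ 2 + 5 = 0) \<or> (b ^ 2 = 0 \<and> 5 * (a ^ 2) ^ 2 + 6 * a ^ 2 + 5 = 0)"
    using that unfolding axis_type_def ax by auto
  show "bitangent_type (l $h i) (l $h j) (l $h k)"
    using classification hyp axis unfolding l bitangent_type_def by (auto simp: power_mult_distrib)
  show "hyperflex_type (l $h i) (l $h j) (l $h k)" if "B ^ 2 - 4 * A * C = 0"
    using classification hyp that disc unfolding l by blast
qed

lemma nonzero_coordinate:
  assumes "l \<noteq> (0 :: complex ^ 3)"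
  obtains i j k where "perm3 i j k" "l $h k \<noteq> 0"
proof -
  have "l $h 1 \<noteq> 0 \<or> l $h 2 \<noteq> 0 \<or> l $h 3 \<noteq> 0"
    using assms by (auto simp: Finite_Cartesian_Product.vec_eq_iff forall_3)
  then show ?thesis using that[of 2 3 1] that[of 1 3 2] that[of 1 2 3] by (auto simp: perm3_def)
qed

lemma bitangent_imp_type:
  assumes "bitangent komiya_kuribayashi l"
  shows "bitangent_type (l $h 1) (l $h 2) (l $h 3)"
proof -
  have "l \<noteq> 0" using assms by (simp add: bitangent_def)
  then obtain i j k where ijk: "perm3 i j k" "l $h k \<noteq> 0" by (rule nonzero_coordinate)
  obtain P Q A B C where "P \<noteq> 0" "Q \<noteq> 0" "on_line l P" "on_line l Q" "\<not> proj_eq P Q"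
    "\<And>u v. kk (u *s P + v *s Q) = (A * u ^ 2 + B * u * v + C * v ^ 2) ^ 2"
    by (rule bitangent_square[OF assms]) blast
  from bitangent_classification(1)[OF ijk this] show ?thesis
    using swap_invariant_perm3[of bitangent_type, OF bitangent_type_swap ijk(1), of "($h) l"] by simp
qed

lemma hyperosculating_imp_type:
  assumes "hyperosculating komiya_kuribayashi l"
  shows "hyperflex_type (l $h 1) (l $h 2) (l $h 3)"
proof -
  have "l \<noteq> 0" using assms by (simp add: hyperosculating_def)
  then obtain i j k where ijk: "perm3 i j k" "l $h k \<noteq> 0" by (rule nonzero_coordinate)
  obtain P Q C where PQ: "P \<noteq> 0" "Q \<noteq> 0" "on_line l P" "on_line l Q" "\<not> proj_eq P Q"
    and kk: "\<And>u v. kk (u *s P + v *s Q) = (C * v ^ 2) ^ 2"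
    by (rule hyperosculating_square[OF assms]) blast
  have "kk (u *s P + v *s Q) = (0 * u ^ 2 + 0 * u * v + C * v ^ 2) ^ 2" for u v by (simp add: kk)
  from bitangent_classification(2)[OF ijk PQ this] show ?thesis
    using swap_invariant_perm3[of hyperflex_type, OF hyperflex_type_swap ijk(1), of "($h) l"] by simp
qed

lemma hyperosculating_normal_form:
  assumes "hyperosculating komiya_kuribayashi l"
  obtains i j k e1 e2 \<beta> where "perm3 i j k" "e1 = 1 \<or> e1 = - 1" "e2 = 1 \<or> e2 = - 1" "\<beta> \<noteq> 0"
    "l $h i = \<beta> * e1" "l $h j = \<beta> * e2" "l $h k = \<beta> * (2 * \<i>)"
proof -
  have nz: "l $h 1 \<noteq> 0 \<or> l $h 2 \<noteq> 0 \<or> l $h 3 \<noteq> 0"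
    using assms by (auto simp: hyperosculating_def Finite_Cartesian_Product.vec_eq_iff forall_3)
  from hyperosculating_imp_type[OF assms] consider
      "(l $h 1) ^ 2 = (l $h 2) ^ 2" "(l $h 3) ^ 2 = - 4 * (l $h 1) ^ 2"
    | "(l $h 1) ^ 2 = (l $h 3) ^ 2" "(l $h 2) ^ 2 = - 4 * (l $h 1) ^ 2"
    | "(l $h 2) ^ 2 = (l $h 3) ^ 2" "(l $h 1) ^ 2 = - 4 * (l $h 2) ^ 2"
    unfolding hyperflex_type_def by blast
  then show ?thesis
  proof cases
    case 1
    show ?thesis by (rule hyperflex_scaling[OF 1]) (use nz that[of 1 2 3] in \<open>auto simp: perm3_def\<close>)
  next
    case 2
    show ?thesis by (rule hyperflex_scaling[OF 2]) (use nz that[of 1 3 2] in \<open>auto simp: perm3_def\<close>)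
  next
    case 3
    show ?thesis by (rule hyperflex_scaling[OF 3]) (use nz that[of 2 3 1] in \<open>auto simp: perm3_def\<close>)
  qed
qed

text \<open>By Cramer's rule the determinant times each coordinate of the common point is a
  combination of the three line equations.\<close>

lemma meet_det_eq_0:
  assumes "x + y + 2 * \<i> * z = 0" "n1 * x + n2 * y + n3 * z = 0" "b1 * x + b2 * y + b3 * z = 0"
    and "x \<noteq> 0 \<or> y \<noteq> 0 \<or> z \<noteq> 0"
  shows "meet_det (n1, n2, n3) (b1, b2, b3) = 0"
proof -
  let ?d = "meet_det (n1, n2, n3) (b1, b2, b3)"
  have "?d * x = (x + y + 2 * \<i> * z) * (n2 * b3 - n3 * b2) + (n1 * x + n2 * y + n3 * z) * (b2 * (2 * \<i>) - b3)
      + (b1 * x + b2 * y + b3 * z) * (n3 - 2 * \<i> * n2)"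
    "?d * y = (x + y + 2 * \<i> * z) * (n3 * b1 - n1 * b3) + (n1 * x + n2 * y + n3 * z) * (b3 - b1 * (2 * \<i>))
      + (b1 * x + b2 * y + b3 * z) * (2 * \<i> * n1 - n3)"
    "?d * z = (x + y + 2 * \<i> * z) * (n1 * b2 - n2 * b1) + (n1 * x + n2 * y + n3 * z) * (b1 - b2)
      + (b1 * x + b2 * y + b3 * z) * (n2 - n1)"
    by (simp_all add: meet_det_def algebra_simps)
  then have "?d * x = 0" "?d * y = 0" "?d * z = 0" unfolding assms(1-3) by simp_all
  then show ?thesis using assms(4) by auto
qed

text \<open>Coordinates adapted to a hyperosculating line: after permuting and changing the signs of
  the variables, this line is x + y + 2 i z = 0.\<close>

locale signed_coordinates =
  fixes i j k :: 3 and e1 e2 :: complex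
  assumes ijk: "perm3 i j k" and signs: "e1 = 1 \<or> e1 = - 1" "e2 = 1 \<or> e2 = - 1"
begin

lemma sign_squares: "e1 * e1 = 1" "e2 * e2 = 1" "e1 * (e1 * x) = x" "e2 * (e2 * x) = x"
  "e1 ^ 2 = 1" "e2 ^ 2 = 1"
  using signs by auto

text \<open>The permutation and the signs sit in this relation instead of acting on the curve, so
  that only the invariant types have to be transferred.\<close>

definition multiple_of :: "complex ^ 3 \<Rightarrow> complex \<Rightarrow> complex \<times> complex \<times> complex \<Rightarrow> bool" where
  "multiple_of l \<beta> t \<longleftrightarrow> \<beta> \<noteq> 0 \<and> e1 * l $h i = \<beta> * fst t \<and> e2 * l $h j = \<beta> * fst (snd t) \<and> l $h k = \<beta> * snd (snd t)"

lemma multiple_ofD: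
  assumes "multiple_of l \<beta> (p, q, r)"
  shows "\<beta> \<noteq> 0" "l $h i = \<beta> * (e1 * p)" "l $h j = \<beta> * (e2 * q)" "l $h k = \<beta> * r"
proof -
  show "\<beta> \<noteq> 0" "l $h k = \<beta> * r" using assms by (simp_all add: multiple_of_def)
  have "e1 * (e1 * l $h i) = \<beta> * (e1 * p)" "e2 * (e2 * l $h j) = \<beta> * (e2 * q)"
    using assms by (simp_all add: multiple_of_def mult_ac)
  then show "l $h i = \<beta> * (e1 * p)" "l $h j = \<beta> * (e2 * q)" by (simp_all only: sign_squares)
qed

lemma multiple_of_proj_eq:
  assumes "multiple_of l \<beta> t" "multiple_of l' \<beta>' t"
  shows "proj_eq l l'"
proof -
  obtain p q r where t: "t = (p, q, r)" by (cases t)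
  note D = multiple_ofD[OF assms(1)[unfolded t]] multiple_ofD[OF assms(2)[unfolded t]]
  show ?thesis
    unfolding proj_eq_def perm3_vec_eq[OF ijk]
    by (intro exI[of _ "\<beta>' / \<beta>"]) (simp add: D)
qed

lemma on_line_signed:
  "on_line l P \<longleftrightarrow> (e1 * l $h i) * (e1 * P $h i) + (e2 * l $h j) * (e2 * P $h j) + l $h k * P $h k = 0"
proof -
  have signs: "(e1 * x) * (e1 * y) = (e1 * e1) * (x * y)" "(e2 * x) * (e2 * y) = (e2 * e2) * (x * y)" for x y
    by (simp_all only: mult_ac)
  show ?thesis by (simp only: on_line_def perm3_sum[OF ijk] signs sign_squares(1,2) mult_1_left)
qed

lemma types_signed:
  "bitangent_type (e1 * x) (e2 * y) z = bitangent_type x y z"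
  "hyperflex_type (e1 * x) (e2 * y) z = hyperflex_type x y z"
proof -
  have "e1 \<noteq> 0" "e2 \<noteq> 0" using signs by auto
  then show "bitangent_type (e1 * x) (e2 * y) z = bitangent_type x y z"
    "hyperflex_type (e1 * x) (e2 * y) z = hyperflex_type x y z"
    by (simp_all add: bitangent_type_def hyperflex_type_def axis_type_def power_mult_distrib sign_squares(5,6))
qed

lemma bitangent_signed_type:
  assumes "bitangent komiya_kuribayashi l"
  shows "bitangent_type (e1 * l $h i) (e2 * l $h j) (l $h k)"
  using bitangent_imp_type[OF assms] unfolding types_signed
  by (simp only: swap_invariant_perm3[of bitangent_type, OF bitangent_type_swap ijk, of "($h) l"])

lemma hyperosculating_signed_type:
  assumes "hyperosculating komiya_kuribayashi l"
  shows "hyperflex_type (e1 * l $h i) (e2 * l $h j) (l $h k)"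
  using hyperosculating_imp_type[OF assms] unfolding types_signed
  by (simp only: swap_invariant_perm3[of hyperflex_type, OF hyperflex_type_swap ijk, of "($h) l"])

lemma nonzero_signed:
  assumes "l \<noteq> 0"
  shows "e1 * l $h i \<noteq> 0 \<or> e2 * l $h j \<noteq> 0 \<or> l $h k \<noteq> 0"
  using assms signs perm3_vec_eq[OF ijk, of l 0] by auto

lemma line_form_multiple_of:
  assumes "multiple_of l \<beta> (p, q, r)"
  shows "line_form l = const \<beta> * (const p * (const e1 * var i) + const q * (const e2 * var j) + const r * var k)"
  unfolding line_form_def perm3_sum[OF ijk] multiple_ofD[OF assms]
  by (simp add: const_simps algebra_simps)

lemma komiya_kuribayashi_signed:
  "komiya_kuribayashi = (const e1 * var i) ^ 4 + (const e2 * var j) ^ 4 + var k ^ 4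
    + 3 * ((const e1 * var i) ^ 2 * (const e2 * var j) ^ 2 + (const e1 * var i) ^ 2 * var k ^ 2
      + (const e2 * var j) ^ 2 * var k ^ 2)"
proof -
  have s: "const e1 ^ 2 = 1" "const e2 ^ 2 = 1"
    using sign_squares(1,2) by (metis const_simps(2,4) power2_eq_square)+
  have s4: "const e1 ^ 4 = 1" "const e2 ^ 4 = 1"
    using power_mult[of "const e1" 2 2] power_mult[of "const e2" 2 2] s by simp_all
  have "komiya_kuribayashi = var i ^ 4 + var j ^ 4 + var k ^ 4
      + 3 * (var i ^ 2 * var j ^ 2 + var i ^ 2 * var k ^ 2 + var j ^ 2 * var k ^ 2)"
    using perm3_cases[OF ijk] by (auto simp: komiya_kuribayashi_def Let_def algebra_simps)
  then show ?thesis by (simp add: power_mult_distrib s s4)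
qed

text \<open>The first line is the reference line of \<open>meet_det\<close>, so the common point
  makes the determinant of the other two with it vanish; \<open>det_axis\<close> and
  \<open>det_lines\<close> then leave one choice for the second hyperosculating line and two for the
  bitangent.\<close>

lemma concurrent_lines:
  assumes h: "multiple_of h1 \<kappa> (1, 1, 2 * \<i>)"
    and h2: "hyperosculating komiya_kuribayashi h2" "\<not> proj_eq h1 h2"
    and b: "bitangent komiya_kuribayashi b" "\<not> proj_eq b h1" "\<not> proj_eq b h2"
    and P: "P \<noteq> 0" "on_line h1 P" "on_line h2 P" "on_line b P"
  shows "(\<exists>\<mu>. multiple_of h2 \<mu> (- 1, - 1, 2 * \<i>)) \<and>
    (\<exists>\<beta>. multiple_of b \<beta> (1, 1, 1) \<or> multiple_of b \<beta> (- 1, - 1, 1))"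
proof -
  define x y z where "x = e1 * P $h i" and "y = e2 * P $h j" and "z = P $h k"
  have xyz: "x \<noteq> 0 \<or> y \<noteq> 0 \<or> z \<noteq> 0" using nonzero_signed[OF P(1)] by (simp add: x_def y_def z_def)
  have on: "p * x + q * y + r * z = 0" if "multiple_of l \<beta> (p, q, r)" "on_line l P" for l \<beta> p q r
  proof -
    have "\<beta> * (p * x + q * y + r * z) = 0"
      using that unfolding on_line_signed by (simp add: multiple_of_def x_def y_def z_def algebra_simps)
    then show ?thesis using multiple_ofD(1)[OF that(1)] by simp
  qed
  have hP: "x + y + 2 * \<i> * z = 0" using on[OF h P(2)] by simp
  have "h2 \<noteq> 0" "b \<noteq> 0" using h2(1) b(1) by (simp_all add: hyperosculating_def bitangent_def)
  obtain \<mu> n1 n2 n3 where \<mu>: "\<mu> \<noteq> 0" and n: "(n1, n2, n3) \<in> hyperflex_lines"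
    and h2n: "e1 * h2 $h i = \<mu> * n1" "e2 * h2 $h j = \<mu> * n2" "h2 $h k = \<mu> * n3"
    by (rule hyperflex_normal_form[OF hyperosculating_signed_type[OF h2(1)] nonzero_signed[OF \<open>h2 \<noteq> 0\<close>]])
  have m2: "multiple_of h2 \<mu> (n1, n2, n3)" by (simp add: multiple_of_def \<mu> h2n)
  then have n_ne: "(n1, n2, n3) \<noteq> (1, 1, 2 * \<i>)" using multiple_of_proj_eq[OF h] h2(2) by metis
  have det: "meet_det (n1, n2, n3) (b1, b2, b3) = 0" if "b1 * x + b2 * y + b3 * z = 0" for b1 b2 b3
    by (rule meet_det_eq_0[OF hP on[OF m2 P(3)] that xyz])
  have "\<not> axis_type (e1 * b $h i) (e2 * b $h j) (b $h k)"
  proof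
    assume "axis_type (e1 * b $h i) (e2 * b $h j) (b $h k)"
    from det_axis[OF n n_ne this nonzero_signed[OF \<open>b \<noteq> 0\<close>]] det show False
      using P(4) by (simp add: on_line_signed x_def y_def z_def)
  qed
  then have "hyperflex_type (e1 * b $h i) (e2 * b $h j) (b $h k)
      \<or> (e1 * b $h i) ^ 2 = (e2 * b $h j) ^ 2 \<and> (e2 * b $h j) ^ 2 = (b $h k) ^ 2"
    using bitangent_signed_type[OF b(1)] by (auto simp: bitangent_type_def)
  then have "\<exists>\<beta> b1 b2 b3. \<beta> \<noteq> 0 \<and> (b1, b2, b3) \<in> hyperflex_lines \<union> diagonal_lines
      \<and> e1 * b $h i = \<beta> * b1 \<and> e2 * b $h j = \<beta> * b2 \<and> b $h k = \<beta> * b3"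
  proof
    assume "hyperflex_type (e1 * b $h i) (e2 * b $h j) (b $h k)"
    then show ?thesis by (rule hyperflex_normal_form[OF _ nonzero_signed[OF \<open>b \<noteq> 0\<close>]]) blast
  next
    assume d: "(e1 * b $h i) ^ 2 = (e2 * b $h j) ^ 2 \<and> (e2 * b $h j) ^ 2 = (b $h k) ^ 2"
    show ?thesis
      by (rule diagonal_normal_form[OF conjunct1[OF d] conjunct2[OF d] nonzero_signed[OF \<open>b \<noteq> 0\<close>]]) blast
  qed
  then obtain \<beta> b1 b2 b3 where \<beta>: "\<beta> \<noteq> 0" and bn: "(b1, b2, b3) \<in> hyperflex_lines \<union> diagonal_lines"
    and bb: "e1 * b $h i = \<beta> * b1" "e2 * b $h j = \<beta> * b2" "b $h k = \<beta> * b3"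
    by (elim exE conjE)
  have mb: "multiple_of b \<beta> (b1, b2, b3)" by (simp add: multiple_of_def \<beta> bb)
  have b_ne: "(b1, b2, b3) \<noteq> (1, 1, 2 * \<i>)" using multiple_of_proj_eq[OF mb, of h1 \<kappa>] h b(2) by metis
  have b_ne': "(b1, b2, b3) \<noteq> (n1, n2, n3)" using multiple_of_proj_eq[OF mb, of h2 \<mu>] m2 b(3) by metis
  have "(n1, n2, n3) = (- 1, - 1, 2 * \<i>) \<and> ((b1, b2, b3) = (1, 1, 1) \<or> (b1, b2, b3) = (- 1, - 1, 1))"
    by (rule det_lines[rule_format, OF n bn n_ne b_ne b_ne' det[OF on[OF mb P(4)]]])
  then show ?thesis using m2 mb by metis
qed

text \<open>The product of the quartic and the lines is a constant times \<open>arr\<close>. As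
  \<open>arr\<close> has degree 8, an eighth root of the constant is absorbed into the coordinate
  forms, which makes the product equal to \<open>f\<close> itself.\<close>

lemma plus_one_generated_signed:
  assumes h1: "multiple_of h1 \<kappa> (1, 1, 2 * \<i>)" and h2: "multiple_of h2 \<mu> (- 1, - 1, 2 * \<i>)"
    and b1: "multiple_of b1 \<beta>1 (1, 1, 1)" and b2: "multiple_of b2 \<beta>2 (- 1, - 1, 1)"
  shows "plus_one_generated (komiya_kuribayashi * line_form b1 * line_form b2 * line_form h1 * line_form h2)"
proof -
  \<comment> \<open>The factor 64 is 16 from the quartic in s, d, t times 4 from
    \<open>4 * s ^ 2 - t ^ 2\<close>.\<close>
  define w where "w = \<beta>1 * \<beta>2 * \<kappa> * \<mu> / 64"
  define \<gamma> where "\<gamma> = csqrt (csqrt (csqrt w))"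
  have "\<gamma> ^ 8 = ((\<gamma> ^ 2) ^ 2) ^ 2" by (simp flip: power_mult)
  then have root8: "\<gamma> ^ 8 = w" by (simp add: \<gamma>_def)
  have "w \<noteq> 0" using multiple_ofD(1)[OF h1] multiple_ofD(1)[OF h2] multiple_ofD(1)[OF b1] multiple_ofD(1)[OF b2]
    by (simp add: w_def)
  then have \<gamma>: "\<gamma> \<noteq> 0" using root8 by auto
  define a b c where "a = vec_lambda (\<lambda>n. if n = i then \<gamma> * e1 else if n = j then \<gamma> * e2 else 0)"
    and "b = vec_lambda (\<lambda>n. if n = i then \<gamma> * e1 else if n = j then - \<gamma> * e2 else 0)"
    and "c = vec_lambda (\<lambda>n. if n = k then 2 * \<gamma> else 0)"
  define a' b' c' where "a' = vec_lambda (\<lambda>n. if n = i then e1 / (2 * \<gamma>) else if n = j then e2 / (2 * \<gamma>) else 0)"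
    and "b' = vec_lambda (\<lambda>n. if n = i then e1 / (2 * \<gamma>) else if n = j then - e2 / (2 * \<gamma>) else 0)"
    and "c' = vec_lambda (\<lambda>n. if n = k then 1 / (2 * \<gamma>) else 0)"
  have ne: "i \<noteq> j" "j \<noteq> i" "i \<noteq> k" "k \<noteq> i" "j \<noteq> k" "k \<noteq> j" using ijk by (auto simp: perm3_def)
  interpret coordinates a b c a' b' c'
    by unfold_locales
      (simp_all add: pairing_def perm3_sum[OF ijk] ne a_def b_def c_def a'_def b'_def c'_def \<gamma> sign_squares)
  define X Y Z where "X = const e1 * var i" and "Y = const e2 * var j" and "Z = var k"
  have SDT: "S = const \<gamma> * (X + Y)" "D = const \<gamma> * (X - Y)" "T = const \<gamma> * (2 * Z)"
    unfolding S_def D_def T_def line_form_def perm3_sum[OF ijk]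
    by (simp_all add: ne a_def b_def c_def X_def Y_def Z_def const_simps algebra_simps)
  have scale: "arr (r * s) (r * d) (r * t) = r ^ 8 * arr s d t" for r s d t :: poly3
    by (simp add: arr_def algebra_simps eval_nat_numeral)
  have "const \<gamma> ^ 8 * 64 = const (\<gamma> ^ 8 * 64)"
    by (simp add: const_simps eval_nat_numeral)
  then have root_const: "const \<gamma> ^ 8 * 64 = const \<beta>1 * const \<beta>2 * const \<kappa> * const \<mu>"
    unfolding root8 by (simp add: w_def const_simps)
  have KK: "komiya_kuribayashi = X ^ 4 + Y ^ 4 + Z ^ 4 + 3 * (X ^ 2 * Y ^ 2 + X ^ 2 * Z ^ 2 + Y ^ 2 * Z ^ 2)"
    unfolding komiya_kuribayashi_signed X_def Y_def Z_def ..
  have i2: "const \<i> * const \<i> = - 1" "const \<i> * (const \<i> * p) = - p" for p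
    by (metis const_simps(2,4,5) i_squared) (metis const_simps(2,4,5) i_squared mult.assoc mult_minus1)
  have "line_form h1 * line_form h2 = const \<kappa> * const \<mu> * (- ((X + Y) ^ 2 + 4 * Z ^ 2))"
    unfolding line_form_multiple_of[OF h1] line_form_multiple_of[OF h2] X_def[symmetric] Y_def[symmetric] Z_def[symmetric]
    by (simp add: const_simps algebra_simps power2_eq_square i2)
  moreover have "line_form b1 * line_form b2 = const \<beta>1 * const \<beta>2 * (Z ^ 2 - (X + Y) ^ 2)"
    unfolding line_form_multiple_of[OF b1] line_form_multiple_of[OF b2] X_def[symmetric] Y_def[symmetric] Z_def[symmetric]
    by (simp add: const_simps algebra_simps power2_eq_square)
  ultimately have "komiya_kuribayashi * line_form b1 * line_form b2 * line_form h1 * line_form h2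
      = (const \<beta>1 * const \<beta>2 * const \<kappa> * const \<mu>) *
        (komiya_kuribayashi * ((X + Y) ^ 2 - Z ^ 2) * ((X + Y) ^ 2 + 4 * Z ^ 2))"
    by (simp add: mult.assoc) (simp add: algebra_simps)
  also have "\<dots> = const \<gamma> ^ 8 * (64 * (komiya_kuribayashi * ((X + Y) ^ 2 - Z ^ 2) * ((X + Y) ^ 2 + 4 * Z ^ 2)))"
    unfolding root_const[symmetric] by (simp only: mult.assoc)
  also have "64 * (komiya_kuribayashi * ((X + Y) ^ 2 - Z ^ 2) * ((X + Y) ^ 2 + 4 * Z ^ 2)) = arr (X + Y) (X - Y) (2 * Z)"
    unfolding KK arr_def by (simp add: algebra_simps eval_nat_numeral)
  also have "const \<gamma> ^ 8 * \<dots> = f" unfolding SDT scale ..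
  finally show ?thesis using plus_one_generated_arr by simp
qed

end

theorem proposition4p5:
  fixes b1 b2 h1 h2 :: "complex ^ 3"
  assumes "bitangent komiya_kuribayashi b1" and "bitangent komiya_kuribayashi b2"
    and "hyperosculating komiya_kuribayashi h1" and "hyperosculating komiya_kuribayashi h2"
    and "\<not> proj_eq b1 b2" and "\<not> proj_eq b1 h1" and "\<not> proj_eq b1 h2"
    and "\<not> proj_eq b2 h1" and "\<not> proj_eq b2 h2" and "\<not> proj_eq h1 h2"
    and "\<exists>P. P \<noteq> 0 \<and> on_line b1 P \<and> on_line b2 P \<and> on_line h1 P \<and> on_line h2 P"
  shows "plus_one_generated
    (komiya_kuribayashi * line_form b1 * line_form b2 * line_form h1 * line_form h2)"
proof -
  obtain P where P: "P \<noteq> 0" "on_line b1 P" "on_line b2 P" "on_line h1 P" "on_line h2 P"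
    using assms(11) by blast
  obtain i j k e1 e2 \<kappa> where ijk: "perm3 i j k" "e1 = 1 \<or> e1 = - 1" "e2 = 1 \<or> e2 = - 1"
    and \<kappa>: "\<kappa> \<noteq> 0" "h1 $h i = \<kappa> * e1" "h1 $h j = \<kappa> * e2" "h1 $h k = \<kappa> * (2 * \<i>)"
    by (rule hyperosculating_normal_form[OF assms(3)])
  interpret signed_coordinates i j k e1 e2 by unfold_locales (rule ijk)+
  have h1: "multiple_of h1 \<kappa> (1, 1, 2 * \<i>)"
    by (simp add: multiple_of_def \<kappa> mult.left_commute[of _ \<kappa>] sign_squares)
  note c1 = concurrent_lines[OF h1 assms(4,10,1,6,7) P(1,4,5,2)]
  note c2 = concurrent_lines[OF h1 assms(4,10,2,8,9) P(1,4,5,3)]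
  obtain \<mu> where h2: "multiple_of h2 \<mu> (- 1, - 1, 2 * \<i>)" using c1 by blast
  obtain \<beta>1 where \<beta>1: "multiple_of b1 \<beta>1 (1, 1, 1) \<or> multiple_of b1 \<beta>1 (- 1, - 1, 1)" using c1 by blast
  obtain \<beta>2 where \<beta>2: "multiple_of b2 \<beta>2 (1, 1, 1) \<or> multiple_of b2 \<beta>2 (- 1, - 1, 1)" using c2 by blast
  \<comment> \<open>Both bitangents are multiples of one of the same two triples; being distinct
    lines, they take one each, in either order.\<close>
  have "(multiple_of b1 \<beta>1 (1, 1, 1) \<and> multiple_of b2 \<beta>2 (- 1, - 1, 1))
      \<or> (multiple_of b2 \<beta>2 (1, 1, 1) \<and> multiple_of b1 \<beta>1 (- 1, - 1, 1))"
    using \<beta>1 \<beta>2 multiple_of_proj_eq assms(5) by blast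
  then show ?thesis
  proof
    assume "multiple_of b1 \<beta>1 (1, 1, 1) \<and> multiple_of b2 \<beta>2 (- 1, - 1, 1)"
    then show ?thesis using plus_one_generated_signed[OF h1 h2] by blast
  next
    assume "multiple_of b2 \<beta>2 (1, 1, 1) \<and> multiple_of b1 \<beta>1 (- 1, - 1, 1)"
    then have "plus_one_generated (komiya_kuribayashi * line_form b2 * line_form b1 * line_form h1 * line_form h2)"
      using plus_one_generated_signed[OF h1 h2] by blast
    then show ?thesis by (simp only: mult_ac)
  qed
qed

end
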